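(* Let $p,q,\upsilon,\gamma_1,\dots,\gamma_6,\sigma,\tau,w_1,w_2\in\mathbb{C}$ with $\operatorname{Re}(p)>0$, $\operatorname{Re}(q)>0$, $\operatorname{Re}(\upsilon)>0$, $\gamma_4,\gamma_5,\gamma_6\notin\{0,-1,-2,\dots\}$, $\operatorname{Re}(\sigma)\ge0$, $\operatorname{Re}(p-\sigma)\ge0$, $\operatorname{Re}(\tau)\ge0$ and $\operatorname{Re}(q-\tau)\ge0$. Let $a,b\in\mathbb{R}$, $z>a$, $t>b$. Then $$\left({}_{z}D_{a^{+}}^{\sigma}\,{}_{t}D_{b^{+}}^{\tau}\right)\left[(z-a)^{p-1}(t-b)^{q-1}E_{\gamma_{4},\gamma_{5},\gamma_{6};p;q;\upsilon}^{(\gamma_{1};\gamma_{2};\gamma_{3})}(w_{1}(z-a),w_{2}(t-b))\right]$$ $$=(z-a)^{p-\sigma-1}(t-b)^{q-\tau-1}E_{\gamma_{4},\gamma_{5},\gamma_{6};p-\sigma;q-\tau;\upsilon}^{(\gamma_{1};\gamma_{2};\gamma_{3})}(w_{1}(z-a),w_{2}(t-b)).$$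
   Context: $(a)_n$ is the Pochhammer symbol. The modified bivariate I-Konhauser Mittag-Leffler function is $$E_{\gamma_{4},\gamma_{5},\gamma_{6};p;q;\upsilon}^{(\gamma_{1};\gamma_{2};\gamma_{3})}(z,t)=\sum_{l=0}^{\infty}\sum_{n=0}^{\infty}\frac{(-1)^{l}(\gamma_{1})_{2l}(\gamma_{2})_{l+n}(\gamma_{3})_{l}\,z^{l}t^{\upsilon n}}{(\gamma_{4})_{l}(\gamma_{5})_{l}(\gamma_{6})_{l}\,\Gamma(p+l)\,\Gamma(q+\upsilon n)\,n!\,l!};$$ the same series is used when $p$ or $q$ has real part $0$, with $1/\Gamma=0$ at poles of $\Gamma$. For $s>0$, $(w_2s)^{\upsilon n}$ means $(w_2^{\upsilon})^n s^{\upsilon n}$ with a fixed choice of $w_2^\upsilon$ (and $w_2^{\upsilon}=0$ if $w_2=0$). For $\operatorname{Re}(\sigma),\operatorname{Re}(\tau)>0$, the double Riemann-Liouville fractional integral is $$\left({}_{z}\mathbb{I}_{a^{+}}^{\sigma}\,{}_{t}\mathbb{I}_{b^{+}}^{\tau}\right)d(z,t)=\frac{1}{\Gamma(\tau)\Gamma(\sigma)}\int_b^t\int_a^z(z-\xi)^{\sigma-1}(t-y)^{\tau-1}d(\xi,y)\,d\xi\,dy,$$ and the double fractional derivative (for $\operatorname{Re}(\sigma),\operatorname{Re}(\tau)\ge0$) is $$\left({}_{z}D_{a^{+}}^{\sigma}\,{}_{t}D_{b^{+}}^{\tau}\right)d(z,t)=\left(\frac{\partial}{\partial t}\right)^{s}\left(\frac{\partial}{\partial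 z}\right)^{k}\left({}_{z}\mathbb{I}_{a^{+}}^{k-\sigma}\,{}_{t}\mathbb{I}_{b^{+}}^{s-\tau}\right)d(z,t),\quad s=[\operatorname{Re}(\tau)]+1,\ k=[\operatorname{Re}(\sigma)]+1,$$ for $z>a$, $t>b$, where $[\cdot]$ is the integer part. *)

theory Defs
  imports "HOL-Analysis.Analysis"
begin

text \<open>
  A value of the multivalued power \<open>w\<^sup>v\<close>: any branch of the logarithm is allowed, and the
  power of \<open>0\<close> is \<open>0\<close>.
\<close>
definition is_power_value :: "complex \<Rightarrow> complex \<Rightarrow> complex \<Rightarrow> bool" where
  "is_power_value w v W \<longleftrightarrow>
     (if w = 0 then W = 0 else \<exists>L. exp L = w \<and> W = exp (v * L))"

text \<open>
  The modified bivariate I-Konhauser Mittag-Leffler function at the arguments \<open>(z, w s)\<close>, for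
  \<open>w\<close> complex and \<open>s > 0\<close> real, where \<open>W\<close> is the chosen value of \<open>w\<^sup>v\<close> and
  \<open>(w s)\<^bsup>v n\<^esup>\<close> is read as \<open>W\<^sup>n s\<^bsup>v n\<^esup>\<close>.  The reciprocals of the Gamma function are taken
  with \<^const>\<open>rGamma\<close>, which is \<open>0\<close> at the poles of \<^const>\<open>Gamma\<close>.
\<close>
definition ikml ::
  "complex \<Rightarrow> complex \<Rightarrow> complex \<Rightarrow> complex \<Rightarrow> complex \<Rightarrow> complex \<Rightarrow>
   complex \<Rightarrow> complex \<Rightarrow> complex \<Rightarrow> complex \<Rightarrow> complex \<Rightarrow> real \<Rightarrow> complex" where
  "ikml \<gamma>1 \<gamma>2 \<gamma>3 \<gamma>4 \<gamma>5 \<gamma>6 p q v W z s =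
     (\<Sum>l. \<Sum>n.
        (-1) ^ l * pochhammer \<gamma>1 (2 * l) * pochhammer \<gamma>2 (l + n) * pochhammer \<gamma>3 l
        * z ^ l * (W ^ n * of_real s powr (v * of_nat n))
        / (pochhammer \<gamma>4 l * pochhammer \<gamma>5 l * pochhammer \<gamma>6 l)
        * rGamma (p + of_nat l) * rGamma (q + v * of_nat n) / (fact n * fact l))"

definition frac_kernel ::
  "complex \<Rightarrow> complex \<Rightarrow> (real \<Rightarrow> real \<Rightarrow> complex) \<Rightarrow> real \<Rightarrow> real \<Rightarrow> real \<Rightarrow> real \<Rightarrow> complex" where
  "frac_kernel \<sigma> \<tau> d z t \<xi> y =
     of_real (z - \<xi>) powr (\<sigma> - 1) * of_real (t - y) powr (\<tau> - 1) * d \<xi> y"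

definition double_frac_integral ::
  "complex \<Rightarrow> complex \<Rightarrow> real \<Rightarrow> real \<Rightarrow> (real \<Rightarrow> real \<Rightarrow> complex) \<Rightarrow> real \<Rightarrow> real \<Rightarrow> complex" where
  "double_frac_integral \<sigma> \<tau> a b d z t =
     1 / (Gamma \<tau> * Gamma \<sigma>) *
     (LINT y:{b..t}|lborel. LINT \<xi>:{a..z}|lborel. frac_kernel \<sigma> \<tau> d z t \<xi> y)"

definition partial_fst :: "(real \<Rightarrow> real \<Rightarrow> complex) \<Rightarrow> real \<Rightarrow> real \<Rightarrow> complex" where
  "partial_fst F z t = vector_derivative (\<lambda>x. F x t) (at z)"

definition partial_snd :: "(real \<Rightarrow> real \<Rightarrow> complex) \<Rightarrow> real \<Rightarrow> real \<Rightarrow> complex" where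
  "partial_snd F z t = vector_derivative (\<lambda>y. F z y) (at t)"

definition deriv_order :: "complex \<Rightarrow> nat" where
  "deriv_order \<sigma> = nat \<lfloor>Re \<sigma>\<rfloor> + 1"

definition double_frac_deriv ::
  "complex \<Rightarrow> complex \<Rightarrow> real \<Rightarrow> real \<Rightarrow> (real \<Rightarrow> real \<Rightarrow> complex) \<Rightarrow> real \<Rightarrow> real \<Rightarrow> complex" where
  "double_frac_deriv \<sigma> \<tau> a b d =
     (partial_snd ^^ deriv_order \<tau>) ((partial_fst ^^ deriv_order \<sigma>)
       (double_frac_integral (of_nat (deriv_order \<sigma>) - \<sigma>) (of_nat (deriv_order \<tau>) - \<tau>) a b d))"

text \<open>
  The integral and \<^const>\<open>vector_derivative\<close> are total, with arbitrary values where the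
  integral or the derivative does not exist.  The following predicate says that every integral and
  every derivative occurring in \<^const>\<open>double_frac_deriv\<close> exists on all of \<open>z > a\<close>, \<open>t > b\<close>.
\<close>
definition has_double_frac_deriv ::
  "complex \<Rightarrow> complex \<Rightarrow> real \<Rightarrow> real \<Rightarrow> (real \<Rightarrow> real \<Rightarrow> complex) \<Rightarrow> bool" where
  "has_double_frac_deriv \<sigma> \<tau> a b d \<longleftrightarrow>
     (let k = deriv_order \<sigma>; s = deriv_order \<tau>;
          F = double_frac_integral (of_nat k - \<sigma>) (of_nat s - \<tau>) a b d
      in \<forall>z>a. \<forall>t>b.
           set_integrable lborel ({a..z} \<times> {b..t})
             (\<lambda>(\<xi>, y). frac_kernel (of_nat k - \<sigma>) (of_nat s - \<tau>) d z t \<xi> y) \<and>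
           (\<forall>i<k. (\<lambda>x. (partial_fst ^^ i) F x t) differentiable at z) \<and>
           (\<forall>j<s. (\<lambda>y. (partial_snd ^^ j) ((partial_fst ^^ k) F) z y) differentiable at t))"

end

theory Submission
  imports Defs "HOL-Real_Asymp.Real_Asymp"
begin

text \<open>
  Write \<open>\<Phi>\<^sub>\<alpha>(x) = x\<^bsup>\<alpha>-1\<^esup> / \<Gamma>(\<alpha>)\<close> for \<open>x > 0\<close> and \<open>\<Phi>\<^sub>\<alpha>(x) = 0\<close> for \<open>x \<le> 0\<close>.  These functions form a
  convolution semigroup, \<open>\<Phi>\<^sub>\<sigma> * \<Phi>\<^sub>\<alpha> = \<Phi>\<^bsub>\<sigma>+\<alpha>\<^esub>\<close> for \<open>Re \<sigma>, Re \<alpha> > 0\<close> (Euler's Beta integral), and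
  \<open>\<Phi>\<^sub>\<alpha>' = \<Phi>\<^bsub>\<alpha>-1\<^esub>\<close> on the positive axis for every complex \<open>\<alpha>\<close>.  The function that is to be
  differentiated is the double series \<open>\<Sum>\<^sub>l \<Sum>\<^sub>n C\<^sub>l\<^sub>n \<Phi>\<^bsub>p+l\<^esub>(x-a) \<Phi>\<^bsub>q+\<upsilon>n\<^esub>(y-b)\<close>, whose coefficients do
  not depend on \<open>p\<close> and \<open>q\<close>.  The double fractional integral of orders \<open>k-\<sigma>\<close> and \<open>s-\<tau>\<close> is convolution
  with \<open>\<Phi>\<^bsub>k-\<sigma>\<^esub>\<close> in one variable and with \<open>\<Phi>\<^bsub>s-\<tau>\<^esub>\<close> in the other, so termwise it raises \<open>p\<close> to
  \<open>p+k-\<sigma>\<close> and \<open>q\<close> to \<open>q+s-\<tau>\<close>; the \<open>k\<close> and \<open>s\<close> derivatives then lower these to \<open>p-\<sigma>\<close> and \<open>q-\<tau>\<close>.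
  Poles of \<open>\<Gamma>\<close> need no separate treatment because \<open>1/\<Gamma>\<close> is entire.
  
  What remains is to justify the termwise operations.  The coefficients grow at most geometrically
  (\<open>double_geometrically_bounded_ikml_coeff\<close>), whereas \<open>1/\<Gamma>(\<beta>+\<upsilon>n)\<close> decays faster than any geometric
  sequence when \<open>Re \<upsilon> > 0\<close> (\<open>summable_rGamma_arith\<close>).  The latter also follows from the Beta
  integral, which bounds \<open>\<bar>\<Gamma>(x)/\<Gamma>(x+\<upsilon>)\<bar>\<close> by a constant times a real Beta integral that tends
  to \<open>0\<close> as \<open>Re x\<close> grows.  Hence all series converge absolutely and locally uniformly, which gives
  \<open>has_vector_derivative_frac_series\<close> and \<open>frac_series_conv\<close> for one variable.  A double series is
  treated as a single series in \<open>x\<close> whose coefficients are series in \<open>y\<close>, or the other way round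
  (\<open>double_frac_series_transpose\<close>), so that the one-variable results apply to each variable in turn.
\<close>

section \<open>The convolution semigroup of causal powers\<close>

text \<open>
  The convolution kernel of the Riemann-Liouville integral of order \<open>\<alpha>\<close>.  With \<^const>\<open>rGamma\<close> it is
  defined for all complex \<open>\<alpha>\<close>, and extending it by \<open>0\<close> turns integrals over bounded intervals into
  convolutions on the whole line.
\<close>
definition causal_power :: "complex \<Rightarrow> real \<Rightarrow> complex" where
  "causal_power \<alpha> x = (if x > 0 then of_real x powr (\<alpha> - 1) * rGamma \<alpha> else 0)"

lemma causal_power_nonpos [simp]: "x \<le> 0 \<Longrightarrow> causal_power \<alpha> x = 0"
  by (simp add: causal_power_def)

lemma norm_causal_power:
  "x > 0 \<Longrightarrow> norm (causal_power \<alpha> x) = x powr (Re \<alpha> - 1) * norm (rGamma \<alpha>)"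
  by (simp add: causal_power_def norm_mult norm_powr_real_powr)

lemma borel_measurable_causal_power [measurable]: "causal_power \<alpha> \<in> borel_measurable borel"
proof -
  have "(\<lambda>x. indicator {0<..} x *\<^sub>R (of_real x powr (\<alpha> - 1) * rGamma \<alpha>)) \<in> borel_measurable borel"
    by (rule borel_measurable_continuous_on_indicator)
       (auto intro!: continuous_intros simp: complex_nonpos_Reals_iff)
  also have "(\<lambda>x. indicator {0<..} x *\<^sub>R (of_real x powr (\<alpha> - 1) * rGamma \<alpha>)) = causal_power \<alpha>"
    by (auto simp: causal_power_def fun_eq_iff)
  finally show ?thesis .
qed

lemma causal_power_scale:
  assumes "x > 0"
  shows "causal_power \<alpha> (x * s) = of_real x powr (\<alpha> - 1) * causal_power \<alpha> s"
  using assms by (auto simp: causal_power_def zero_less_mult_iff powr_times_real)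

lemma Gamma_neq_zero: "Gamma \<alpha> \<noteq> 0" if "Re \<alpha> > 0" for \<alpha> :: complex
  using that by (auto simp: Gamma_eq_zero_iff elim!: nonpos_Ints_cases)

text \<open>
  Euler's integral for \<open>\<Gamma>\<close>, normalised: the Laplace transform of a causal power at \<open>1\<close> is \<open>1\<close>.
\<close>
lemma laplace_causal_power:
  assumes "Re \<alpha> > 0"
  shows "integrable lborel (\<lambda>t. exp (- t) *\<^sub>R causal_power \<alpha> t)"
    and "(LINT t|lborel. exp (- t) *\<^sub>R causal_power \<alpha> t) = 1"
proof -
  let ?g = "\<lambda>t. of_real t powr (\<alpha> - 1) / of_real (exp t) * rGamma \<alpha>"
  have eq: "(\<lambda>t. exp (- t) *\<^sub>R causal_power \<alpha> t) = (\<lambda>t. indicator {0<..} t *\<^sub>R ?g t)"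
    by (auto simp: causal_power_def fun_eq_iff scaleR_conv_of_real exp_minus field_simps)
  have "set_integrable lebesgue {0<..} ?g"
    by (rule set_integrable_mult_left, rule absolutely_integrable_Gamma_integral') (use assms in auto)
  then have "integrable lebesgue (\<lambda>t. exp (- t) *\<^sub>R causal_power \<alpha> t)"
    unfolding set_integrable_def eq .
  then show int: "integrable lborel (\<lambda>t. exp (- t) *\<^sub>R causal_power \<alpha> t)"
    by (subst (asm) integrable_completion) auto
  have nz: "Gamma \<alpha> \<noteq> 0" using assms by (rule Gamma_neq_zero)
  have "(?g has_integral Gamma \<alpha> * rGamma \<alpha>) {0<..}"
    by (rule has_integral_mult_left, rule Gamma_integral_complex') (use assms in auto)
  then have "((\<lambda>t. if t \<in> {0<..} then ?g t else 0) has_integral Gamma \<alpha> * rGamma \<alpha>) UNIV"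
    by (simp only: has_integral_restrict_UNIV)
  also have "(\<lambda>t. if t \<in> {0<..} then ?g t else 0) = (\<lambda>t. exp (- t) *\<^sub>R causal_power \<alpha> t)"
    unfolding eq by (auto simp: fun_eq_iff indicator_def)
  also have "Gamma \<alpha> * rGamma \<alpha> = 1" using nz by (simp add: rGamma_inverse_Gamma)
  finally have "((\<lambda>t. exp (- t) *\<^sub>R causal_power \<alpha> t) has_integral 1) UNIV" .
  then show "(LINT t|lborel. exp (- t) *\<^sub>R causal_power \<alpha> t) = 1"
    using has_integral_integral_lborel[OF int] has_integral_unique by blast
qed

text \<open>
  On the unit interval the absolute value of the integrand is a real Beta integrand; the general case
  follows by the affine substitution \<open>s \<mapsto> a + (z - a) s\<close>.
\<close>
lemma integrable_causal_power_conv: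
  assumes "Re \<alpha> > 0" "Re \<beta> > 0"
  shows "integrable lborel (\<lambda>s. causal_power \<alpha> (z - s) * causal_power \<beta> (s - a))"
proof (cases "z > a")
  case False
  then have "(\<lambda>s. causal_power \<alpha> (z - s) * causal_power \<beta> (s - a)) = (\<lambda>s. 0)"
    by (auto simp: fun_eq_iff causal_power_def)
  then show ?thesis by simp
next
  case True
  define x where "x = z - a"
  have x: "x > 0" using True by (simp add: x_def)
  have "integrable lborel (\<lambda>s. norm (rGamma \<alpha> * rGamma \<beta>) *
          (indicator {0..1} s *\<^sub>R (s powr (Re \<beta> - 1) * (1 - s) powr (Re \<alpha> - 1))))"
    using integrable_Beta[of "Re \<beta>" "Re \<alpha>"] assms unfolding set_integrable_def
    by (intro integrable_mult_right) auto
  then have "integrable lborel (\<lambda>s. causal_power \<alpha> (1 - s) * causal_power \<beta> s)"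
  proof (rule Bochner_Integration.integrable_bound)
    have "norm (causal_power \<alpha> (1 - s) * causal_power \<beta> s) \<le>
        norm (norm (rGamma \<alpha> * rGamma \<beta>) *
          (indicator {0..1} s *\<^sub>R (s powr (Re \<beta> - 1) * (1 - s) powr (Re \<alpha> - 1))))" for s
    proof (cases "0 < s \<and> s < 1")
      case True
      then show ?thesis by (simp add: norm_mult norm_causal_power mult_ac abs_mult)
    next
      case False
      then have "s \<le> 0 \<or> 1 - s \<le> 0" by auto
      then have "causal_power \<alpha> (1 - s) * causal_power \<beta> s = 0" by auto
      then show ?thesis by (simp only: norm_zero norm_ge_zero)
    qed
    then show "AE s in lborel. norm (causal_power \<alpha> (1 - s) * causal_power \<beta> s) \<le>
        norm (norm (rGamma \<alpha> * rGamma \<beta>) *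
          (indicator {0..1} s *\<^sub>R (s powr (Re \<beta> - 1) * (1 - s) powr (Re \<alpha> - 1))))" by simp
  qed measurable
  then have "integrable lborel (\<lambda>s. (of_real x powr (\<alpha> - 1) * of_real x powr (\<beta> - 1)) *
                (causal_power \<alpha> (1 - s) * causal_power \<beta> s))"
    by (intro integrable_mult_right)
  also have "(\<lambda>s. (of_real x powr (\<alpha> - 1) * of_real x powr (\<beta> - 1)) *
                (causal_power \<alpha> (1 - s) * causal_power \<beta> s))
    = (\<lambda>s. causal_power \<alpha> (z - (a + x * s)) * causal_power \<beta> ((a + x * s) - a))"
  proof
    fix s
    have "z - (a + x * s) = x * (1 - s)" "(a + x * s) - a = x * s"
      by (simp_all add: x_def algebra_simps)
    then show "(of_real x powr (\<alpha> - 1) * of_real x powr (\<beta> - 1)) *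
                (causal_power \<alpha> (1 - s) * causal_power \<beta> s)
       = causal_power \<alpha> (z - (a + x * s)) * causal_power \<beta> ((a + x * s) - a)"
      using causal_power_scale[OF x] by simp
  qed
  finally show ?thesis
    using x by (subst (asm) lborel_integrable_real_affine_iff
       [of x "\<lambda>s. causal_power \<alpha> (z - s) * causal_power \<beta> (s - a)" a]) auto
qed

text \<open>
  Homogeneity reduces the convolution to its value at \<open>1\<close>.
\<close>
lemma causal_power_conv_scale:
  assumes "x > 0"
  shows "(LINT s|lborel. causal_power \<alpha> (x - s) * causal_power \<beta> s) =
           of_real x powr (\<alpha> + \<beta> - 1) * (LINT s|lborel. causal_power \<alpha> (1 - s) * causal_power \<beta> s)"
proof -
  have "(LINT s|lborel. causal_power \<alpha> (x - s) * causal_power \<beta> s) =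
        x *\<^sub>R (LINT s|lborel. causal_power \<alpha> (x - x * s) * causal_power \<beta> (x * s))"
    using assms lborel_integral_real_affine[of x "\<lambda>s. causal_power \<alpha> (x - s) * causal_power \<beta> s" 0]
    by simp
  also have "(\<lambda>s. causal_power \<alpha> (x - x * s) * causal_power \<beta> (x * s)) =
     (\<lambda>s. (of_real x powr (\<alpha> - 1) * of_real x powr (\<beta> - 1)) *
                (causal_power \<alpha> (1 - s) * causal_power \<beta> s))"
    using causal_power_scale[OF assms, of \<alpha> "1 - s" for s] causal_power_scale[OF assms, of \<beta>]
    by (auto simp: fun_eq_iff right_diff_distrib)
  also have "x *\<^sub>R (LINT s|lborel. (of_real x powr (\<alpha> - 1) * of_real x powr (\<beta> - 1)) *
                (causal_power \<alpha> (1 - s) * causal_power \<beta> s)) =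
      (of_real x * (of_real x powr (\<alpha> - 1) * of_real x powr (\<beta> - 1))) *
       (LINT s|lborel. causal_power \<alpha> (1 - s) * causal_power \<beta> s)"
    by (simp add: scaleR_conv_of_real)
  also have "of_real x * (of_real x powr (\<alpha> - 1) * of_real x powr (\<beta> - 1)) =
      (of_real x :: complex) powr (\<alpha> + \<beta> - 1)"
  proof -
    have "of_real x * (of_real x powr (\<alpha> - 1) * of_real x powr (\<beta> - 1)) =
      of_real x powr 1 * (of_real x powr (\<alpha> - 1) * of_real x powr (\<beta> - 1) :: complex)"
      using assms by simp
    also have "\<dots> = of_real x powr (\<alpha> + \<beta> - 1)"
      by (simp only: powr_add [symmetric]) (simp add: algebra_simps)
    finally show ?thesis .
  qed
  finally show ?thesis .
qed

text \<open>
  After the shift \<open>x = s + r\<close> the integrand splits into a product of two Laplace integrands.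
\<close>
lemma integrable_laplace_conv:
  assumes "Re \<alpha> > 0" "Re \<beta> > 0"
  shows "integrable (lborel \<Otimes>\<^sub>M lborel)
           (\<lambda>(s, x). exp (- x) *\<^sub>R (causal_power \<alpha> (x - s) * causal_power \<beta> s))"
proof (rule lborel_pair.Fubini_integrable)
  let ?f = "\<lambda>(s, x). exp (- x) *\<^sub>R (causal_power \<alpha> (x - s) * causal_power \<beta> s)"
  show "?f \<in> borel_measurable (lborel \<Otimes>\<^sub>M lborel)" by measurable
  \<comment> \<open>The factor \<open>1\<close> matches the affine substitution rule for the Lebesgue measure.\<close>
  have eq: "?f (s, s + 1 * r) = (exp (- s) *\<^sub>R causal_power \<beta> s) * (exp (- r) *\<^sub>R causal_power \<alpha> r)" for s r
    by (simp add: exp_diff scaleR_conv_of_real exp_minus field_simps exp_add)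
  have "integrable lborel (\<lambda>r. ?f (s, s + 1 * r))" for s
    unfolding eq using laplace_causal_power(1)[OF assms(1)] by (rule integrable_mult_right)
  then have "integrable lborel (\<lambda>x. ?f (s, x))" for s
    by (rule lborel_integrable_real_affine_iff[THEN iffD1, rotated]) simp
  then show "AE s in lborel. integrable lborel (\<lambda>x. ?f (s, x))" by simp
  have "(LINT x|lborel. norm (?f (s, x))) =
     norm (exp (- s) *\<^sub>R causal_power \<beta> s) * (LINT r|lborel. norm (exp (- r) *\<^sub>R causal_power \<alpha> r))" for s
    by (subst lborel_integral_real_affine[of 1 _ s]) (simp_all only: eq norm_mult, auto)
  then show "integrable lborel (\<lambda>s. LINT x|lborel. norm (?f (s, x)))"
    by (simp only:) (intro integrable_mult_left integrable_norm laplace_causal_power assms)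
qed

text \<open>
  Euler's Beta integral for complex parameters.  The Laplace transform of a convolution is the product
  of the Laplace transforms, hence equal to \<open>1\<close>; by homogeneity it is also \<open>\<Gamma>(\<alpha> + \<beta>)\<close> times the
  convolution at \<open>1\<close>.
\<close>
lemma causal_power_conv_unit:
  assumes "Re \<alpha> > 0" "Re \<beta> > 0"
  shows "(LINT s|lborel. causal_power \<alpha> (1 - s) * causal_power \<beta> s) = rGamma (\<alpha> + \<beta>)"
proof -
  define B where "B = (LINT s|lborel. causal_power \<alpha> (1 - s) * causal_power \<beta> s)"
  let ?f = "\<lambda>s x. exp (- x) *\<^sub>R (causal_power \<alpha> (x - s) * causal_power \<beta> s)"
  have eq: "?f s (s + 1 * r) = (exp (- s) *\<^sub>R causal_power \<beta> s) * (exp (- r) *\<^sub>R causal_power \<alpha> r)" for s r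
    by (simp add: exp_diff scaleR_conv_of_real exp_minus field_simps exp_add)
  have "(LINT x|lborel. ?f s x) = exp (- s) *\<^sub>R causal_power \<beta> s" for s
  proof -
    have "(LINT x|lborel. ?f s x) = \<bar>1\<bar> *\<^sub>R (LINT r|lborel. ?f s (s + 1 * r))"
      by (rule lborel_integral_real_affine) simp
    also have "\<dots> = exp (- s) *\<^sub>R causal_power \<beta> s"
      unfolding eq integral_mult_right_zero by (simp add: laplace_causal_power assms)
    finally show ?thesis .
  qed
  then have "1 = (LINT s|lborel. LINT x|lborel. ?f s x)"
    by (simp add: laplace_causal_power assms)
  also have "\<dots> = (LINT x|lborel. LINT s|lborel. ?f s x)"
    using lborel_pair.Fubini_integral[OF integrable_laplace_conv[OF assms]] by simp
  also have "(\<lambda>x. LINT s|lborel. ?f s x) =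
      (\<lambda>x. (exp (- x) *\<^sub>R causal_power (\<alpha> + \<beta>) x) * (Gamma (\<alpha> + \<beta>) * B))"
  proof
    fix x :: real
    have nz: "Gamma (\<alpha> + \<beta>) \<noteq> 0"
      using assms by (intro Gamma_neq_zero) simp
    show "(LINT s|lborel. ?f s x) =
        (exp (- x) *\<^sub>R causal_power (\<alpha> + \<beta>) x) * (Gamma (\<alpha> + \<beta>) * B)"
    proof (cases "x > 0")
      case True
      then show ?thesis using nz
        by (simp add: causal_power_conv_scale flip: B_def)
           (simp add: causal_power_def rGamma_inverse_Gamma)
    next
      case False
      then have "(\<lambda>s. ?f s x) = (\<lambda>s. 0)" by (auto simp: fun_eq_iff causal_power_def)
      then show ?thesis using False by simp
    qed
  qed
  also have "(LINT x|lborel. (exp (- x) *\<^sub>R causal_power (\<alpha> + \<beta>) x) * (Gamma (\<alpha> + \<beta>) * B)) =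
     Gamma (\<alpha> + \<beta>) * B"
    unfolding integral_mult_left_zero using assms by (simp add: laplace_causal_power)
  finally have "1 = Gamma (\<alpha> + \<beta>) * B" .
  then have "inverse (Gamma (\<alpha> + \<beta>)) = B" by (intro inverse_unique) simp
  then show ?thesis by (simp add: rGamma_inverse_Gamma B_def)
qed

lemma causal_power_convolution:
  assumes "Re \<alpha> > 0" "Re \<beta> > 0"
  shows "(LINT s|lborel. causal_power \<alpha> (z - s) * causal_power \<beta> (s - a)) = causal_power (\<alpha> + \<beta>) (z - a)"
proof -
  have "(LINT s|lborel. causal_power \<alpha> (z - s) * causal_power \<beta> (s - a)) =
      (LINT s|lborel. causal_power \<alpha> ((z - a) - s) * causal_power \<beta> s)"
    by (subst lborel_integral_real_affine[of 1 _ a]) (simp_all add: algebra_simps)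
  also have "\<dots> = causal_power (\<alpha> + \<beta>) (z - a)"
  proof (cases "z > a")
    case True
    then show ?thesis
      by (simp only: causal_power_conv_scale[of "z - a"] causal_power_conv_unit[OF assms] diff_gt_0_iff_gt)
         (simp add: causal_power_def)
  next
    case False
    then have "(\<lambda>s. causal_power \<alpha> ((z - a) - s) * causal_power \<beta> s) = (\<lambda>s. 0)"
      by (auto simp: fun_eq_iff causal_power_def)
    then show ?thesis using False by simp
  qed
  finally show ?thesis .
qed

section \<open>Decay of the reciprocal Gamma function\<close>

text \<open>
  The triangle inequality for the Beta integral.  It controls the quotient of two values of \<open>1/\<Gamma>\<close>
  whose arguments differ by \<open>\<upsilon>\<close>.
\<close>
lemma norm_rGamma_add_le:
  assumes "Re \<alpha> > 0" "Re \<upsilon> > 0"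
  shows "norm (rGamma (\<alpha> + \<upsilon>)) \<le> norm (rGamma \<upsilon>) * norm (rGamma \<alpha>) *
     (LINT s|lborel. indicator {0<..<1} s * (1 - s) powr (Re \<upsilon> - 1) * s powr (Re \<alpha> - 1))"
proof -
  have "rGamma (\<alpha> + \<upsilon>) = (LINT s|lborel. causal_power \<upsilon> (1 - s) * causal_power \<alpha> s)"
    using causal_power_conv_unit[of \<upsilon> \<alpha>] assms by (simp add: add.commute)
  also have "norm \<dots> \<le> (LINT s|lborel. norm (causal_power \<upsilon> (1 - s) * causal_power \<alpha> s))"
    by (rule integral_norm_bound)
  also have "(\<lambda>s. norm (causal_power \<upsilon> (1 - s) * causal_power \<alpha> s)) =
     (\<lambda>s. norm (rGamma \<upsilon>) * norm (rGamma \<alpha>) *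
        (indicator {0<..<1} s * (1 - s) powr (Re \<upsilon> - 1) * s powr (Re \<alpha> - 1)))"
  proof
    fix s
    show "norm (causal_power \<upsilon> (1 - s) * causal_power \<alpha> s) =
     norm (rGamma \<upsilon>) * norm (rGamma \<alpha>) *
        (indicator {0<..<1} s * (1 - s) powr (Re \<upsilon> - 1) * s powr (Re \<alpha> - 1))"
      by (cases "s \<le> 0"; cases "1 - s \<le> 0") (simp_all add: norm_mult norm_causal_power indicator_def)
  qed
  finally show ?thesis by simp
qed

lemma beta_integral_tendsto_0:
  fixes r :: real
  assumes "r > 0"
  shows "((\<lambda>a. LINT s|lborel. indicator {0<..<1} s * (1 - s) powr (r - 1) * s powr (a - 1)) \<longlongrightarrow> 0) at_top"
proof -
  let ?w = "\<lambda>s. indicator {0<..<1} s * (1 - s) powr (r - 1) :: real"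
  have "((\<lambda>a. LINT s|lborel. ?w s * s powr (a - 1)) \<longlongrightarrow> (LINT s|(lborel :: real measure). (0::real))) at_top"
  proof (rule integral_dominated_convergence_at_top[where w = ?w])
    have "integrable lborel (\<lambda>s. indicator {0..1} s *\<^sub>R (s powr (1 - 1) * (1 - s) powr (r - 1)))"
      using integrable_Beta[of 1 r] assms unfolding set_integrable_def by simp
    then show "integrable lborel ?w"
      by (rule Bochner_Integration.integrable_bound) (auto simp: indicator_def)
    show "\<forall>\<^sub>F a in at_top. AE s in lborel. norm (?w s * s powr (a - 1)) \<le> ?w s"
      using eventually_ge_at_top[of 1]
    proof eventually_elim
      case (elim a)
      have "s powr (a - 1) \<le> 1" if "0 < s" "s < 1" for s
        using powr_mono2[of "a - 1" s 1] elim that by simp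
      then have "norm (?w s * s powr (a - 1)) \<le> ?w s" for s
        by (auto simp: indicator_def abs_mult intro!: mult_left_le)
      then show ?case by simp
    qed
    show "AE s in lborel. ((\<lambda>a. ?w s * s powr (a - 1)) \<longlongrightarrow> 0) at_top"
    proof (rule AE_I2)
      fix s :: real
      show "((\<lambda>a. ?w s * s powr (a - 1)) \<longlongrightarrow> 0) at_top"
      proof (cases "0 < s \<and> s < 1")
        case True
        then have "((\<lambda>a. s powr (a - 1)) \<longlongrightarrow> 0) at_top"
          by real_asymp
        then show ?thesis by (rule tendsto_mult_right_zero)
      qed (auto simp: indicator_def)
    qed
  qed measurable
  then show ?thesis by simp
qed

text \<open>
  The ratio test: by the two preceding lemmas the quotient of consecutive terms tends to \<open>0\<close>,
  whatever \<open>K\<close> is.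
\<close>
theorem summable_rGamma_arith:
  fixes \<beta> \<upsilon> :: complex and K :: real
  assumes "Re \<upsilon> > 0"
  shows "summable (\<lambda>n. norm (rGamma (\<beta> + \<upsilon> * of_nat n)) * K ^ n)"
proof -
  let ?J = "\<lambda>a. LINT s|lborel. indicator {0<..<1} s * (1 - s) powr (Re \<upsilon> - 1) * s powr (a - 1)"
  define q where "q = norm (rGamma \<upsilon>) * \<bar>K\<bar>"
  have lim: "filterlim (\<lambda>n. Re \<beta> + Re \<upsilon> * real n) at_top sequentially"
    using assms by real_asymp
  have "((\<lambda>a. q * ?J a) \<longlongrightarrow> 0) at_top"
    by (intro tendsto_mult_right_zero beta_integral_tendsto_0 assms)
  then have "\<forall>\<^sub>F a in at_top. q * ?J a < 1 / 2 \<and> a > 0"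
    by (intro eventually_conj order_tendstoD eventually_gt_at_top) auto
  from eventually_compose_filterlim[OF this lim] obtain N
    where N: "\<And>n. n \<ge> N \<Longrightarrow> q * ?J (Re \<beta> + Re \<upsilon> * real n) < 1 / 2 \<and> Re \<beta> + Re \<upsilon> * real n > 0"
    by (auto simp: eventually_sequentially)
  show ?thesis
  proof (rule summable_ratio_test)
    fix n assume n: "n \<ge> N"
    define x where "x = \<beta> + \<upsilon> * of_nat n"
    have x: "Re x = Re \<beta> + Re \<upsilon> * real n" by (simp add: x_def)
    have "norm (rGamma (\<beta> + \<upsilon> * of_nat (Suc n))) = norm (rGamma (x + \<upsilon>))"
      by (simp add: x_def algebra_simps)
    also have "\<dots> \<le> norm (rGamma \<upsilon>) * norm (rGamma x) * ?J (Re x)"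
      using N[OF n] assms x by (intro norm_rGamma_add_le) auto
    finally have "norm (norm (rGamma (\<beta> + \<upsilon> * of_nat (Suc n))) * K ^ Suc n) \<le>
        norm (rGamma \<upsilon>) * norm (rGamma x) * ?J (Re x) * \<bar>K\<bar> ^ Suc n"
      by (simp add: abs_mult power_abs mult_right_mono)
    also have "\<dots> = (q * ?J (Re x)) * (norm (rGamma x) * \<bar>K\<bar> ^ n)"
      by (simp add: q_def)
    also have "\<dots> \<le> 1 / 2 * (norm (rGamma x) * \<bar>K\<bar> ^ n)"
      using N[OF n] unfolding x by (intro mult_right_mono) auto
    finally show "norm (norm (rGamma (\<beta> + \<upsilon> * of_nat (Suc n))) * K ^ Suc n) \<le>
        1 / 2 * norm (norm (rGamma (\<beta> + \<upsilon> * of_nat n)) * K ^ n)"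
      by (simp add: x_def abs_mult power_abs)
  qed simp
qed

section \<open>Series of causal powers\<close>

text \<open>
  At most geometric growth is the condition on the coefficients because it is inherited by the
  row sums of a double series, and the decay of \<open>1/\<Gamma>\<close> absorbs every geometric factor.
\<close>
definition geometrically_bounded :: "(nat \<Rightarrow> complex) \<Rightarrow> bool" where
  "geometrically_bounded c \<longleftrightarrow> (\<exists>M A. \<forall>n. norm (c n) \<le> M * A ^ n)"

definition frac_series :: "(nat \<Rightarrow> complex) \<Rightarrow> complex \<Rightarrow> complex \<Rightarrow> real \<Rightarrow> complex" where
  "frac_series c \<alpha> \<mu> x = (\<Sum>n. c n * causal_power (\<alpha> + \<mu> * of_nat n) x)"

text \<open>
  The majorant separates the behaviour at \<open>0\<close>, which is the same for all \<open>n\<close>, from a factor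
  that is uniform in \<open>x \<le> X\<close>.  All dominations of series below use it.
\<close>
lemma norm_causal_power_arith_le:
  assumes "0 < x" "x \<le> X" "Re \<mu> \<ge> 0"
  shows "norm (causal_power (\<alpha> + \<mu> * of_nat n) x) \<le>
     x powr (Re \<alpha> - 1) * (norm (rGamma (\<alpha> + \<mu> * of_nat n)) * (X powr Re \<mu>) ^ n)"
proof -
  have "x powr (Re (\<alpha> + \<mu> * of_nat n) - 1) = x powr (Re \<alpha> - 1) * (x powr Re \<mu>) ^ n"
  proof -
    have "x powr (Re \<alpha> - 1) * (x powr Re \<mu>) ^ n = x powr (Re \<alpha> - 1 + Re \<mu> * real n)"
      using assms by (simp only: powr_add) (simp add: powr_power mult.commute)
    then show ?thesis by (simp add: algebra_simps)
  qed
  also have "\<dots> \<le> x powr (Re \<alpha> - 1) * (X powr Re \<mu>) ^ n"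
    using assms by (intro mult_left_mono power_mono powr_mono2) auto
  finally have "x powr (Re (\<alpha> + \<mu> * of_nat n) - 1) * norm (rGamma (\<alpha> + \<mu> * of_nat n)) \<le>
      (x powr (Re \<alpha> - 1) * (X powr Re \<mu>) ^ n) * norm (rGamma (\<alpha> + \<mu> * of_nat n))"
    by (intro mult_right_mono) auto
  then show ?thesis
    unfolding norm_causal_power[OF assms(1)] by (simp only: mult_ac)
qed

lemma summable_geometric_rGamma:
  assumes "geometrically_bounded c" "Re \<mu> > 0"
  shows "summable (\<lambda>n. norm (c n) * (norm (rGamma (\<alpha> + \<mu> * of_nat n)) * K ^ n))"
proof -
  obtain M A where MA: "\<And>n. norm (c n) \<le> M * A ^ n"
    using assms(1) by (auto simp: geometrically_bounded_def)
  have "summable (\<lambda>n. M * (norm (rGamma (\<alpha> + \<mu> * of_nat n)) * \<bar>A * K\<bar> ^ n))"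
    by (intro summable_mult summable_rGamma_arith assms)
  then show ?thesis
  proof (rule summable_comparison_test'[where N = 0])
    fix n
    have "norm (c n) \<le> M * \<bar>A\<bar> ^ n"
    proof -
      have "M \<ge> 0" using MA[of 0] norm_ge_zero[of "c 0"] by (simp del: norm_ge_zero)
      then have "M * A ^ n \<le> M * \<bar>A\<bar> ^ n"
        by (intro mult_left_mono) (simp_all flip: power_abs)
      then show ?thesis using MA[of n] by linarith
    qed
    then have "norm (c n) * (norm (rGamma (\<alpha> + \<mu> * of_nat n)) * \<bar>K\<bar> ^ n) \<le>
        M * \<bar>A\<bar> ^ n * (norm (rGamma (\<alpha> + \<mu> * of_nat n)) * \<bar>K\<bar> ^ n)"
      by (intro mult_right_mono) auto
    then show "norm (norm (c n) * (norm (rGamma (\<alpha> + \<mu> * of_nat n)) * K ^ n)) \<le>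
        M * (norm (rGamma (\<alpha> + \<mu> * of_nat n)) * \<bar>A * K\<bar> ^ n)"
      by (simp add: abs_mult power_abs power_mult_distrib mult_ac)
  qed
qed

lemma summable_frac_series:
  assumes "geometrically_bounded c" "Re \<mu> > 0"
  shows "summable (\<lambda>n. norm (c n * causal_power (\<alpha> + \<mu> * of_nat n) x))"
proof (cases "x > 0")
  case True
  have "summable (\<lambda>n. x powr (Re \<alpha> - 1) *
     (norm (c n) * (norm (rGamma (\<alpha> + \<mu> * of_nat n)) * (x powr Re \<mu>) ^ n)))"
    by (intro summable_mult summable_geometric_rGamma assms)
  then show ?thesis
  proof (rule summable_comparison_test'[where N = 0])
    fix n
    show "norm (norm (c n * causal_power (\<alpha> + \<mu> * of_nat n) x)) \<le> x powr (Re \<alpha> - 1) *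
     (norm (c n) * (norm (rGamma (\<alpha> + \<mu> * of_nat n)) * (x powr Re \<mu>) ^ n))"
      using mult_left_mono[OF norm_causal_power_arith_le[of x x \<mu> \<alpha> n], of "norm (c n)"] True assms(2)
      by (simp add: norm_mult mult_ac)
  qed
qed auto

lemma borel_measurable_frac_series [measurable]: "frac_series c \<alpha> \<mu> \<in> borel_measurable borel"
  unfolding frac_series_def[abs_def] by measurable

text \<open>
  The power rule produces the factor \<open>\<alpha> - 1\<close>, which \<open>1/\<Gamma>(\<alpha> - 1) = (\<alpha> - 1)/\<Gamma>(\<alpha>)\<close> absorbs,
  including at the poles of \<open>\<Gamma>\<close>.
\<close>
lemma has_vector_derivative_causal_power:
  assumes "x > 0"
  shows "(causal_power \<alpha> has_vector_derivative causal_power (\<alpha> - 1) x) (at x)"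
proof -
  have "((\<lambda>z. z powr (\<alpha> - 1) * rGamma \<alpha>) has_field_derivative
      ((\<alpha> - 1) * of_real x powr (\<alpha> - 1 - 1)) * rGamma \<alpha>) (at (complex_of_real x))"
    using assms by (auto intro!: derivative_eq_intros simp: complex_nonpos_Reals_iff)
  then have "((\<lambda>x. of_real x powr (\<alpha> - 1) * rGamma \<alpha>) has_vector_derivative
      ((\<alpha> - 1) * of_real x powr (\<alpha> - 1 - 1)) * rGamma \<alpha>) (at x)"
    by (rule has_vector_derivative_real_field)
  also have "((\<alpha> - 1) * of_real x powr (\<alpha> - 1 - 1)) * rGamma \<alpha> = causal_power (\<alpha> - 1) x"
    using assms rGamma_plus1[of "\<alpha> - 1"] by (simp add: causal_power_def mult_ac)
  finally show ?thesis
    by (rule has_vector_derivative_transform_within_open[of _ _ _ "{0<..}"])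
       (use assms in \<open>auto simp: causal_power_def\<close>)
qed

lemma powr_le_endpoints:
  fixes a b y e :: real
  assumes "0 < a" "a \<le> y" "y \<le> b"
  shows "y powr e \<le> a powr e + b powr e"
proof (cases "e \<ge> 0")
  case True
  then have "y powr e \<le> b powr e" using assms by (intro powr_mono2) auto
  then show ?thesis using powr_ge_zero[of a e] by linarith
next
  case False
  then have "y powr e \<le> a powr e" using assms by (intro powr_mono2') auto
  then show ?thesis using powr_ge_zero[of b e] by linarith
qed

text \<open>
  The differentiated series converges uniformly near \<open>x\<close> by the Weierstrass test; the neighbourhood
  \<open>(x/2, 2x)\<close> keeps away from the singularity at \<open>0\<close>.
\<close>
theorem has_vector_derivative_frac_series:
  assumes c: "geometrically_bounded c" and \<mu>: "Re \<mu> > 0" and x: "x > 0"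
  shows "(frac_series c \<alpha> \<mu> has_vector_derivative frac_series c (\<alpha> - 1) \<mu> x) (at x)"
proof -
  define S where "S = {x / 2<..<2 * x}"
  define u where "u = (\<lambda>n y. c n * causal_power (\<alpha> - 1 + \<mu> * of_nat n) y)"
  define D where "D = (x / 2) powr (Re (\<alpha> - 1) - 1) + (2 * x) powr (Re (\<alpha> - 1) - 1)"
  have xS: "x \<in> S" using x by (simp add: S_def)
  have unif: "uniform_limit S (\<lambda>n y. \<Sum>i<n. u i y) (\<lambda>y. frac_series c (\<alpha> - 1) \<mu> y) sequentially"
    unfolding frac_series_def u_def
  proof (rule Weierstrass_m_test)
    fix n y assume "y \<in> S"
    then have y: "0 < y" "x / 2 \<le> y" "y \<le> 2 * x" using x by (auto simp: S_def)
    have "norm (causal_power (\<alpha> - 1 + \<mu> * of_nat n) y) \<le>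
        y powr (Re (\<alpha> - 1) - 1) * (norm (rGamma (\<alpha> - 1 + \<mu> * of_nat n)) * ((2 * x) powr Re \<mu>) ^ n)"
      using y \<mu> by (intro norm_causal_power_arith_le) auto
    also have "\<dots> \<le> D * (norm (rGamma (\<alpha> - 1 + \<mu> * of_nat n)) * ((2 * x) powr Re \<mu>) ^ n)"
      unfolding D_def using x y by (intro mult_right_mono powr_le_endpoints) auto
    finally have "norm (c n) * norm (causal_power (\<alpha> - 1 + \<mu> * of_nat n) y) \<le>
        norm (c n) * (D * (norm (rGamma (\<alpha> - 1 + \<mu> * of_nat n)) * ((2 * x) powr Re \<mu>) ^ n))"
      by (rule mult_left_mono) simp
    then show "norm (c n * causal_power (\<alpha> - 1 + \<mu> * of_nat n) y) \<le>
        D * (norm (c n) * (norm (rGamma (\<alpha> - 1 + \<mu> * of_nat n)) * ((2 * x) powr Re \<mu>) ^ n))"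
      by (simp only: norm_mult mult.left_commute)
  next
    show "summable (\<lambda>n. D * (norm (c n) * (norm (rGamma (\<alpha> - 1 + \<mu> * of_nat n)) * ((2 * x) powr Re \<mu>) ^ n)))"
      by (intro summable_mult summable_geometric_rGamma c \<mu>)
  qed
  have "\<exists>g. \<forall>y\<in>S. (\<lambda>n. c n * causal_power (\<alpha> + \<mu> * of_nat n) y) sums (g y) \<and>
      (g has_derivative (\<lambda>h. h *\<^sub>R frac_series c (\<alpha> - 1) \<mu> y)) (at y within S)"
  proof (rule has_derivative_series)
    show "convex S" by (simp add: S_def)
    show "x \<in> S" by (rule xS)
    show "(\<lambda>n. c n * causal_power (\<alpha> + \<mu> * of_nat n) x) sums frac_series c \<alpha> \<mu> x"
      unfolding frac_series_def
      using summable_norm_cancel[OF summable_frac_series[OF c \<mu>]] by (rule summable_sums)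
    show "((\<lambda>y. c n * causal_power (\<alpha> + \<mu> * of_nat n) y) has_derivative (\<lambda>h. h *\<^sub>R u n y)) (at y within S)"
      if "y \<in> S" for n y
    proof -
      have "y > 0" using that x by (simp add: S_def)
      have "((\<lambda>y. c n * causal_power (\<alpha> + \<mu> * of_nat n) y) has_vector_derivative
          c n * causal_power (\<alpha> + \<mu> * of_nat n - 1) y) (at y)"
        by (intro has_vector_derivative_mult_right has_vector_derivative_causal_power \<open>y > 0\<close>)
      also have "c n * causal_power (\<alpha> + \<mu> * of_nat n - 1) y = u n y"
        by (simp add: u_def algebra_simps)
      finally have "((\<lambda>y. c n * causal_power (\<alpha> + \<mu> * of_nat n) y) has_vector_derivative u n y) (at y within S)"
        by (rule has_vector_derivative_at_within)
      then show ?thesis by (simp only: has_vector_derivative_def)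
    qed
    fix e :: real assume e: "e > 0"
    show "\<forall>\<^sub>F n in sequentially. \<forall>y\<in>S. \<forall>h. norm ((\<Sum>i<n. h *\<^sub>R u i y) - h *\<^sub>R frac_series c (\<alpha> - 1) \<mu> y) \<le> e * norm h"
      using uniform_limitD[OF unif e]
    proof eventually_elim
      case (elim n)
      have "norm ((\<Sum>i<n. h *\<^sub>R u i y) - h *\<^sub>R frac_series c (\<alpha> - 1) \<mu> y) \<le> e * norm h" if "y \<in> S" for h y
      proof -
        have "norm ((\<Sum>i<n. h *\<^sub>R u i y) - h *\<^sub>R frac_series c (\<alpha> - 1) \<mu> y) =
            norm h * dist (\<Sum>i<n. u i y) (frac_series c (\<alpha> - 1) \<mu> y)"
          by (simp only: dist_norm real_norm_def norm_scaleR
                scaleR_sum_right [symmetric] scaleR_diff_right [symmetric])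
        also have "\<dots> \<le> norm h * e"
          using elim that by (intro mult_left_mono) (auto intro: less_imp_le)
        finally show ?thesis by (simp add: mult.commute)
      qed
      then show ?case by simp
    qed
  qed
  then obtain g where g: "\<forall>y\<in>S. (\<lambda>n. c n * causal_power (\<alpha> + \<mu> * of_nat n) y) sums (g y) \<and>
      (g has_derivative (\<lambda>h. h *\<^sub>R frac_series c (\<alpha> - 1) \<mu> y)) (at y within S)" ..
  have g_eq: "g y = frac_series c \<alpha> \<mu> y" if "y \<in> S" for y
    unfolding frac_series_def using g that by (intro sums_unique) simp
  have "(g has_derivative (\<lambda>h. h *\<^sub>R frac_series c (\<alpha> - 1) \<mu> x)) (at x within S)"
    using g xS by simp
  moreover have "open S" by (simp add: S_def)
  ultimately have "(g has_vector_derivative frac_series c (\<alpha> - 1) \<mu> x) (at x)"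
    by (simp only: has_vector_derivative_def at_within_open[OF xS])
  then show ?thesis
    by (rule has_vector_derivative_transform_within_open[of _ _ _ S]) (use \<open>open S\<close> xS g_eq in auto)
qed

text \<open>
  Termwise integration.  The integral of the absolute value of the \<open>n\<close>-th term is at most the
  summable majorant times the single integral \<open>I\<close> that belongs to \<open>n = 0\<close>, so that Beta integrals
  need not be estimated individually.
\<close>
theorem
  assumes c: "geometrically_bounded c" and \<mu>: "Re \<mu> > 0" and \<sigma>: "Re \<sigma> > 0" and \<alpha>: "Re \<alpha> > 0"
  shows integrable_frac_series_conv:
      "integrable lborel (\<lambda>\<xi>. causal_power \<sigma> (z - \<xi>) * frac_series c \<alpha> \<mu> (\<xi> - a))"
    and frac_series_conv:
      "(LINT \<xi>|lborel. causal_power \<sigma> (z - \<xi>) * frac_series c \<alpha> \<mu> (\<xi> - a)) = frac_series c (\<sigma> + \<alpha>) \<mu> (z - a)"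
proof -
  define f where "f = (\<lambda>n \<xi>. c n * (causal_power \<sigma> (z - \<xi>) * causal_power (\<alpha> + \<mu> * of_nat n) (\<xi> - a)))"
  have re: "Re (\<alpha> + \<mu> * of_nat n) > 0" for n
    using \<alpha> \<mu> by (simp add: add_pos_nonneg)
  have int: "integrable lborel (f n)" for n
    unfolding f_def by (intro integrable_mult_right integrable_causal_power_conv \<sigma> re)
  have sum_f: "summable (\<lambda>n. norm (f n \<xi>))" for \<xi>
    using summable_mult[OF summable_frac_series[OF c \<mu>, of \<alpha> "\<xi> - a"], of "norm (causal_power \<sigma> (z - \<xi>))"]
    by (simp add: f_def norm_mult mult_ac)
  have suminf_f: "(\<Sum>n. f n \<xi>) = causal_power \<sigma> (z - \<xi>) * frac_series c \<alpha> \<mu> (\<xi> - a)" for \<xi>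
    using suminf_mult[OF summable_norm_cancel[OF summable_frac_series[OF c \<mu>, of \<alpha> "\<xi> - a"]], of "causal_power \<sigma> (z - \<xi>)"]
    by (simp add: f_def frac_series_def mult_ac)
  define I where "I = (LINT \<xi>|lborel. norm (causal_power \<sigma> (z - \<xi>) * causal_power \<alpha> (\<xi> - a)))"
  define X where "X = z - a"
  have nz: "rGamma \<alpha> \<noteq> 0" using Gamma_neq_zero[OF \<alpha>] by (auto simp: Gamma_def)
  have bound: "(LINT \<xi>|lborel. norm (f n \<xi>)) \<le>
     I / norm (rGamma \<alpha>) * (norm (c n) * (norm (rGamma (\<alpha> + \<mu> * of_nat n)) * (X powr Re \<mu>) ^ n))" (is "_ \<le> ?b n") for n
  proof -
    define K where "K = norm (c n) * (norm (rGamma (\<alpha> + \<mu> * of_nat n)) * (X powr Re \<mu>) ^ n) / norm (rGamma \<alpha>)"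
    have "(LINT \<xi>|lborel. norm (f n \<xi>)) \<le>
       (LINT \<xi>|lborel. norm (causal_power \<sigma> (z - \<xi>) * causal_power \<alpha> (\<xi> - a)) * K)"
    proof (rule integral_mono)
      show "integrable lborel (\<lambda>\<xi>. norm (f n \<xi>))" using int by (rule integrable_norm)
      show "integrable lborel (\<lambda>\<xi>. norm (causal_power \<sigma> (z - \<xi>) * causal_power \<alpha> (\<xi> - a)) * K)"
        by (intro integrable_mult_left integrable_norm integrable_causal_power_conv \<sigma> \<alpha>)
      fix \<xi>
      show "norm (f n \<xi>) \<le> norm (causal_power \<sigma> (z - \<xi>) * causal_power \<alpha> (\<xi> - a)) * K"
      proof (cases "a < \<xi> \<and> \<xi> < z")
        case True
        then have "norm (causal_power (\<alpha> + \<mu> * of_nat n) (\<xi> - a)) \<le> (\<xi> - a) powr (Re \<alpha> - 1) *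
            (norm (rGamma (\<alpha> + \<mu> * of_nat n)) * (X powr Re \<mu>) ^ n)"
          using \<mu> by (intro norm_causal_power_arith_le) (auto simp: X_def)
        then have "norm (f n \<xi>) \<le> norm (c n) * (norm (causal_power \<sigma> (z - \<xi>)) * ((\<xi> - a) powr (Re \<alpha> - 1) *
            (norm (rGamma (\<alpha> + \<mu> * of_nat n)) * (X powr Re \<mu>) ^ n)))"
          unfolding f_def norm_mult by (intro mult_left_mono) auto
        also have "\<dots> = norm (causal_power \<sigma> (z - \<xi>) * causal_power \<alpha> (\<xi> - a)) * K"
          using True nz by (simp add: norm_mult norm_causal_power K_def field_simps)
        finally show ?thesis .
      next
        case False
        then have "z - \<xi> \<le> 0 \<or> \<xi> - a \<le> 0" by auto
        then show ?thesis by (auto simp: f_def)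
      qed
    qed
    also have "\<dots> = ?b n" by (simp add: I_def K_def)
    finally show ?thesis .
  qed
  have "summable ?b"
    by (intro summable_mult summable_geometric_rGamma c \<mu>)
  then have sum_int: "summable (\<lambda>n. LINT \<xi>|lborel. norm (f n \<xi>))"
    by (rule summable_comparison_test') (use bound in \<open>auto simp: integral_nonneg_AE\<close>)
  note AE = AE_I2[of lborel "\<lambda>\<xi>. summable (\<lambda>n. norm (f n \<xi>))", OF sum_f]
  show "integrable lborel (\<lambda>\<xi>. causal_power \<sigma> (z - \<xi>) * frac_series c \<alpha> \<mu> (\<xi> - a))"
    using integrable_suminf[OF int AE sum_int] by (simp only: suminf_f)
  have "(LINT \<xi>|lborel. causal_power \<sigma> (z - \<xi>) * frac_series c \<alpha> \<mu> (\<xi> - a)) = (\<Sum>n. LINT \<xi>|lborel. f n \<xi>)"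
    using integral_suminf[OF int AE sum_int] by (simp only: suminf_f)
  also have "\<dots> = frac_series c (\<sigma> + \<alpha>) \<mu> (z - a)"
    unfolding frac_series_def f_def integral_mult_right_zero causal_power_convolution[OF \<sigma> re]
    by (simp add: add.assoc)
  finally show "(LINT \<xi>|lborel. causal_power \<sigma> (z - \<xi>) * frac_series c \<alpha> \<mu> (\<xi> - a)) = frac_series c (\<sigma> + \<alpha>) \<mu> (z - a)" .
qed

section \<open>Double series of causal powers\<close>

lemma suminf_swap_dominated:
  fixes f :: "nat \<Rightarrow> nat \<Rightarrow> complex"
  assumes f: "\<And>l n. norm (f l n) \<le> g l * h n" and g: "summable g" and h: "summable h"
    and nonneg: "\<And>l. g l \<ge> 0" "\<And>n. h n \<ge> 0"
  shows "(\<Sum>l. \<Sum>n. f l n) = (\<Sum>n. \<Sum>l. f l n)"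
proof -
  have row: "summable (\<lambda>n. norm (f l n))" for l
    by (rule summable_comparison_test'[OF summable_mult[OF h, of "g l"], of 0]) (use f in auto)
  have col: "summable (\<lambda>l. norm (f l n))" for n
    by (rule summable_comparison_test'[OF summable_mult2[OF g, of "h n"], of 0]) (use f in auto)
  have row_le: "(\<Sum>n. norm (f l n)) \<le> g l * suminf h" for l
    using suminf_le[OF f row summable_mult[OF h]] suminf_mult[OF h] by simp
  have col_le: "(\<Sum>l. norm (f l n)) \<le> suminf g * h n" for n
    using suminf_le[OF f col summable_mult2[OF g]] suminf_mult2[OF g] by simp
  have sum_row: "summable (\<lambda>l. norm (\<Sum>n. f l n))"
    by (rule summable_comparison_test'[OF summable_mult2[OF g, of "suminf h"], of 0])
       (use row_le summable_norm[OF row] in \<open>auto intro: order_trans\<close>)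
  have sum_col: "summable (\<lambda>n. norm (\<Sum>l. f l n))"
    by (rule summable_comparison_test'[OF summable_mult[OF h, of "suminf g"], of 0])
       (use col_le summable_norm[OF col] in \<open>auto intro: order_trans\<close>)
  have inf_row: "infsum (\<lambda>n. norm (f l n)) UNIV = (\<Sum>n. norm (f l n))" for l
    by (rule infsumI, rule norm_summable_imp_has_sum) (use row in \<open>auto intro: summable_sums\<close>)
  have "summable (\<lambda>l. norm (\<Sum>n. norm (f l n)))"
    by (rule summable_comparison_test'[OF summable_mult2[OF g, of "suminf h"], of 0])
       (use row_le suminf_nonneg[OF row] in auto)
  then have "(\<lambda>p. norm (case p of (l, n) \<Rightarrow> f l n)) summable_on (UNIV \<times> UNIV)"
    using row unfolding Infinite_Sum.abs_summable_on_Sigma_iff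
    by (auto simp: inf_row intro!: norm_summable_imp_summable_on)
  then have "(\<lambda>(l, n). f l n) summable_on (UNIV \<times> UNIV)"
    by (rule abs_summable_summable)
  from infsum_swap_banach[OF this]
  have "infsum (\<lambda>l. infsum (\<lambda>n. f l n) UNIV) UNIV = infsum (\<lambda>n. infsum (\<lambda>l. f l n) UNIV) UNIV" .
  moreover have "infsum (\<lambda>n. f l n) UNIV = (\<Sum>n. f l n)" for l
    by (rule infsumI, rule norm_summable_imp_has_sum)
       (use row in \<open>auto intro: summable_sums summable_norm_cancel\<close>)
  moreover have "infsum (\<lambda>l. f l n) UNIV = (\<Sum>l. f l n)" for n
    by (rule infsumI, rule norm_summable_imp_has_sum)
       (use col in \<open>auto intro: summable_sums summable_norm_cancel\<close>)
  moreover have "infsum (\<lambda>l. \<Sum>n. f l n) UNIV = (\<Sum>l. \<Sum>n. f l n)"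
    by (rule infsumI, rule norm_summable_imp_has_sum)
       (use sum_row in \<open>auto intro: summable_sums summable_norm_cancel\<close>)
  moreover have "infsum (\<lambda>n. \<Sum>l. f l n) UNIV = (\<Sum>n. \<Sum>l. f l n)"
    by (rule infsumI, rule norm_summable_imp_has_sum)
       (use sum_col in \<open>auto intro: summable_sums summable_norm_cancel\<close>)
  ultimately show ?thesis by simp
qed

definition double_geometrically_bounded :: "(nat \<Rightarrow> nat \<Rightarrow> complex) \<Rightarrow> bool" where
  "double_geometrically_bounded C \<longleftrightarrow> (\<exists>M A. M \<ge> 0 \<and> A \<ge> 0 \<and> (\<forall>l n. norm (C l n) \<le> M * A ^ l * A ^ n))"

text \<open>
  The series is nested on purpose: for fixed \<open>y\<close> it is literally a series of causal powers in \<open>x\<close>,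
  to which the one-variable results apply.
\<close>
definition double_frac_series ::
  "(nat \<Rightarrow> nat \<Rightarrow> complex) \<Rightarrow> complex \<Rightarrow> complex \<Rightarrow> complex \<Rightarrow> complex \<Rightarrow> real \<Rightarrow> real \<Rightarrow> complex" where
  "double_frac_series C \<alpha> \<mu> \<beta> \<upsilon> x y = frac_series (\<lambda>l. frac_series (C l) \<beta> \<upsilon> y) \<alpha> \<mu> x"

lemma double_geometrically_bounded_row:
  assumes "double_geometrically_bounded C"
  shows "geometrically_bounded (C l)"
  using assms unfolding double_geometrically_bounded_def geometrically_bounded_def by blast

lemma double_geometrically_bounded_transpose:
  assumes "double_geometrically_bounded C"
  shows "double_geometrically_bounded (\<lambda>n l. C l n)"
proof -
  obtain M A where MA: "M \<ge> 0" "A \<ge> 0" "\<And>l n. norm (C l n) \<le> M * A ^ l * A ^ n"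
    using assms unfolding double_geometrically_bounded_def by blast
  have "\<forall>n l. norm (C l n) \<le> M * A ^ n * A ^ l"
    using MA(3) by (metis mult.commute mult.left_commute)
  then show ?thesis
    unfolding double_geometrically_bounded_def using MA(1,2) by blast
qed

lemma frac_series_nonpos [simp]: "x \<le> 0 \<Longrightarrow> frac_series c \<alpha> \<mu> x = 0"
  by (simp add: frac_series_def)

lemma norm_frac_series_le:
  assumes c: "geometrically_bounded c" and \<mu>: "Re \<mu> > 0" and x: "x \<le> X"
  shows "norm (frac_series c \<alpha> \<mu> x) \<le> x powr (Re \<alpha> - 1) *
    (\<Sum>n. norm (c n) * (norm (rGamma (\<alpha> + \<mu> * of_nat n)) * (X powr Re \<mu>) ^ n))"
proof (cases "x > 0")
  case True
  have bnd: "norm (c n * causal_power (\<alpha> + \<mu> * of_nat n) x) \<le> x powr (Re \<alpha> - 1) *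
     (norm (c n) * (norm (rGamma (\<alpha> + \<mu> * of_nat n)) * (X powr Re \<mu>) ^ n))" for n
    using mult_left_mono[OF norm_causal_power_arith_le[of x X \<mu> \<alpha> n], of "norm (c n)"] True x \<mu>
    by (simp add: norm_mult mult_ac)
  have "norm (frac_series c \<alpha> \<mu> x) \<le> (\<Sum>n. norm (c n * causal_power (\<alpha> + \<mu> * of_nat n) x))"
    unfolding frac_series_def by (intro summable_norm summable_frac_series c \<mu>)
  also have "\<dots> \<le> (\<Sum>n. x powr (Re \<alpha> - 1) *
     (norm (c n) * (norm (rGamma (\<alpha> + \<mu> * of_nat n)) * (X powr Re \<mu>) ^ n)))"
    by (intro suminf_le bnd summable_frac_series summable_mult summable_geometric_rGamma c \<mu>)
  also have "\<dots> = x powr (Re \<alpha> - 1) *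
     (\<Sum>n. norm (c n) * (norm (rGamma (\<alpha> + \<mu> * of_nat n)) * (X powr Re \<mu>) ^ n))"
    by (intro suminf_mult summable_geometric_rGamma c \<mu>)
  finally show ?thesis .
next
  case False
  then show ?thesis
    by (auto intro!: mult_nonneg_nonneg suminf_nonneg summable_geometric_rGamma c \<mu>)
qed

text \<open>
  The bound has to be uniform in \<open>y \<le> Y\<close>, apart from the singular factor, to serve for integration
  over a rectangle.
\<close>
lemma norm_row_frac_series_le:
  assumes C: "double_geometrically_bounded C" and \<upsilon>: "Re \<upsilon> > 0"
  obtains E A where "E \<ge> 0" "A \<ge> 0"
    "\<And>l y. y \<le> Y \<Longrightarrow> norm (frac_series (C l) \<beta> \<upsilon> y) \<le> y powr (Re \<beta> - 1) * (E * A ^ l)"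
proof -
  obtain M A where MA: "M \<ge> 0" "A \<ge> 0" "\<And>l n. norm (C l n) \<le> M * A ^ l * A ^ n"
    using C unfolding double_geometrically_bounded_def by blast
  let ?R = "\<lambda>n. norm (rGamma (\<beta> + \<upsilon> * of_nat n)) * (Y powr Re \<upsilon>) ^ n"
  have sR: "summable (\<lambda>n. A ^ n * ?R n)"
    using summable_rGamma_arith[OF \<upsilon>, of \<beta> "A * Y powr Re \<upsilon>"]
    by (simp add: power_mult_distrib mult_ac)
  define E where "E = M * (\<Sum>n. A ^ n * ?R n)"
  have "norm (frac_series (C l) \<beta> \<upsilon> y) \<le> y powr (Re \<beta> - 1) * (E * A ^ l)" if "y \<le> Y" for l y
  proof -
    note row = double_geometrically_bounded_row[OF C, of l]
    have "(\<Sum>n. norm (C l n) * ?R n) \<le> (\<Sum>n. M * A ^ l * (A ^ n * ?R n))"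
    proof (intro suminf_le summable_geometric_rGamma row \<upsilon> summable_mult sR)
      fix n
      show "norm (C l n) * ?R n \<le> M * A ^ l * (A ^ n * ?R n)"
        using mult_right_mono[OF MA(3)[of l n], of "?R n"] by (simp add: mult_ac)
    qed
    also have "\<dots> = E * A ^ l" by (simp add: suminf_mult[OF sR] E_def)
    finally have "y powr (Re \<beta> - 1) * (\<Sum>n. norm (C l n) * ?R n) \<le> y powr (Re \<beta> - 1) * (E * A ^ l)"
      by (rule mult_left_mono) simp
    with norm_frac_series_le[OF row \<upsilon> that, of \<beta>] show ?thesis by linarith
  qed
  moreover have "E \<ge> 0" unfolding E_def using MA sR by (intro mult_nonneg_nonneg suminf_nonneg) auto
  ultimately show ?thesis using MA(2) that by blast
qed

lemma geometrically_bounded_row_sums: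
  assumes C: "double_geometrically_bounded C" and \<upsilon>: "Re \<upsilon> > 0"
  shows "geometrically_bounded (\<lambda>l. frac_series (C l) \<beta> \<upsilon> y)"
proof -
  obtain E A where EA: "E \<ge> 0" "A \<ge> 0"
    "\<And>l y'. y' \<le> y \<Longrightarrow> norm (frac_series (C l) \<beta> \<upsilon> y') \<le> y' powr (Re \<beta> - 1) * (E * A ^ l)"
    using norm_row_frac_series_le[OF C \<upsilon>, of y \<beta>] by blast
  show ?thesis
    unfolding geometrically_bounded_def using EA(3)[of y]
    by (intro exI[of _ "y powr (Re \<beta> - 1) * E"] exI[of _ A]) (simp add: mult_ac)
qed

text \<open>
  On a rectangle the double series is dominated by a product of powers.  This reduces its
  integrability against a product kernel to the convolution of two causal powers in each variable.
\<close>
lemma norm_double_frac_series_le: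
  assumes C: "double_geometrically_bounded C" and \<mu>: "Re \<mu> > 0" and \<upsilon>: "Re \<upsilon> > 0"
  obtains K where "K \<ge> 0" "\<And>x y. x \<le> X \<Longrightarrow> y \<le> Y \<Longrightarrow>
    norm (double_frac_series C \<alpha> \<mu> \<beta> \<upsilon> x y) \<le> K * (x powr (Re \<alpha> - 1) * y powr (Re \<beta> - 1))"
proof -
  obtain E A where EA: "E \<ge> 0" "A \<ge> 0"
    "\<And>l y. y \<le> Y \<Longrightarrow> norm (frac_series (C l) \<beta> \<upsilon> y) \<le> y powr (Re \<beta> - 1) * (E * A ^ l)"
    using norm_row_frac_series_le[OF C \<upsilon>, of Y \<beta>] by blast
  let ?R = "\<lambda>l. norm (rGamma (\<alpha> + \<mu> * of_nat l)) * (X powr Re \<mu>) ^ l"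
  have sR: "summable (\<lambda>l. A ^ l * ?R l)"
    using summable_rGamma_arith[OF \<mu>, of \<alpha> "A * X powr Re \<mu>"]
    by (simp add: power_mult_distrib mult_ac)
  define K where "K = E * (\<Sum>l. A ^ l * ?R l)"
  have "norm (double_frac_series C \<alpha> \<mu> \<beta> \<upsilon> x y) \<le> K * (x powr (Re \<alpha> - 1) * y powr (Re \<beta> - 1))"
    if x: "x \<le> X" and y: "y \<le> Y" for x y
  proof -
    note gb = geometrically_bounded_row_sums[OF C \<upsilon>, of \<beta> y]
    have "(\<Sum>l. norm (frac_series (C l) \<beta> \<upsilon> y) * ?R l) \<le> (\<Sum>l. y powr (Re \<beta> - 1) * E * (A ^ l * ?R l))"
    proof (intro suminf_le summable_geometric_rGamma gb \<mu> summable_mult sR)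
      fix l
      show "norm (frac_series (C l) \<beta> \<upsilon> y) * ?R l \<le> y powr (Re \<beta> - 1) * E * (A ^ l * ?R l)"
        using mult_right_mono[OF EA(3)[OF y, of l], of "?R l"] by (simp add: mult_ac)
    qed
    also have "\<dots> = y powr (Re \<beta> - 1) * K" by (simp add: suminf_mult[OF sR] K_def)
    finally have "x powr (Re \<alpha> - 1) * (\<Sum>l. norm (frac_series (C l) \<beta> \<upsilon> y) * ?R l) \<le>
        x powr (Re \<alpha> - 1) * (y powr (Re \<beta> - 1) * K)"
      by (rule mult_left_mono) simp
    then show ?thesis
      using norm_frac_series_le[OF gb \<mu> x, of \<alpha>] by (simp add: double_frac_series_def mult_ac)
  qed
  moreover have "K \<ge> 0" unfolding K_def using EA sR by (intro mult_nonneg_nonneg suminf_nonneg) auto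
  ultimately show ?thesis using that by blast
qed

text \<open>
  The summations may be interchanged because the terms are dominated by a product of two summable
  sequences.
\<close>
theorem double_frac_series_transpose:
  assumes C: "double_geometrically_bounded C" and \<mu>: "Re \<mu> > 0" and \<upsilon>: "Re \<upsilon> > 0"
  shows "double_frac_series C \<alpha> \<mu> \<beta> \<upsilon> x y = double_frac_series (\<lambda>n l. C l n) \<beta> \<upsilon> \<alpha> \<mu> y x"
proof -
  obtain M A where MA: "M \<ge> 0" "A \<ge> 0" "\<And>l n. norm (C l n) \<le> M * A ^ l * A ^ n"
    using C unfolding double_geometrically_bounded_def by blast
  let ?f = "\<lambda>l n. C l n * causal_power (\<alpha> + \<mu> * of_nat l) x * causal_power (\<beta> + \<upsilon> * of_nat n) y"
  have "\<forall>n. norm (complex_of_real (A ^ n)) \<le> 1 * A ^ n"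
    using MA(2) by (simp add: norm_power)
  then have A1: "geometrically_bounded (\<lambda>n. of_real (A ^ n))"
    unfolding geometrically_bounded_def by blast
  have "\<forall>l. norm (complex_of_real (M * A ^ l)) \<le> M * A ^ l"
    using MA(1,2) by (simp add: norm_mult norm_power)
  then have A2: "geometrically_bounded (\<lambda>l. of_real (M * A ^ l))"
    unfolding geometrically_bounded_def by blast
  have "double_frac_series C \<alpha> \<mu> \<beta> \<upsilon> x y = (\<Sum>l. \<Sum>n. ?f l n)"
    unfolding double_frac_series_def frac_series_def
    by (subst suminf_mult2[OF summable_norm_cancel[OF
          summable_frac_series[OF double_geometrically_bounded_row[OF C] \<upsilon>]]])
       (simp add: mult_ac)
  also have "\<dots> = (\<Sum>n. \<Sum>l. ?f l n)"
  proof (rule suminf_swap_dominated)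
    show "norm (?f l n) \<le> norm (of_real (M * A ^ l) * causal_power (\<alpha> + \<mu> * of_nat l) x) *
             norm (of_real (A ^ n) * causal_power (\<beta> + \<upsilon> * of_nat n) y)" for l n
      using mult_right_mono[OF MA(3)[of l n], of "norm (causal_power (\<alpha> + \<mu> * of_nat l) x) *
         norm (causal_power (\<beta> + \<upsilon> * of_nat n) y)"] MA(1,2)
      by (simp add: norm_mult norm_power mult_ac)
    show "summable (\<lambda>l. norm (of_real (M * A ^ l) * causal_power (\<alpha> + \<mu> * of_nat l) x))"
      by (rule summable_frac_series[OF A2 \<mu>])
    show "summable (\<lambda>n. norm (of_real (A ^ n) * causal_power (\<beta> + \<upsilon> * of_nat n) y))"
      by (rule summable_frac_series[OF A1 \<upsilon>])
  qed auto
  also have "\<dots> = double_frac_series (\<lambda>n l. C l n) \<beta> \<upsilon> \<alpha> \<mu> y x"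
    unfolding double_frac_series_def frac_series_def
    by (subst suminf_mult2[OF summable_norm_cancel[OF
          summable_frac_series[OF double_geometrically_bounded_row[OF
            double_geometrically_bounded_transpose[OF C]] \<mu>]]])
       (simp add: mult_ac)
  finally show ?thesis .
qed

lemma borel_measurable_double_frac_series [measurable]:
  "(\<lambda>w. double_frac_series C \<alpha> \<mu> \<beta> \<upsilon> (fst w - a) (snd w - b)) \<in> borel_measurable (lborel \<Otimes>\<^sub>M lborel)"
  unfolding double_frac_series_def frac_series_def by measurable

lemma integrable_lborel_prod_mult:
  fixes g h :: "real \<Rightarrow> real"
  assumes g: "integrable lborel g" and h: "integrable lborel h"
  shows "integrable (lborel \<Otimes>\<^sub>M lborel) (\<lambda>w. g (fst w) * h (snd w))"
proof (rule lborel_pair.Fubini_integrable)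
  have [measurable]: "g \<in> borel_measurable borel" "h \<in> borel_measurable borel"
    using g h by (auto dest: borel_measurable_integrable)
  show "(\<lambda>w. g (fst w) * h (snd w)) \<in> borel_measurable (lborel \<Otimes>\<^sub>M lborel)" by measurable
  show "integrable lborel (\<lambda>x. LINT y|lborel. norm (g (fst (x, y)) * h (snd (x, y))))"
    unfolding fst_conv snd_conv norm_mult integral_mult_right_zero
    by (intro integrable_mult_left integrable_norm g)
  show "AE x in lborel. integrable lborel (\<lambda>y. g (fst (x, y)) * h (snd (x, y)))"
    using h by simp
qed

lemma integrable_double_frac_series_conv:
  assumes C: "double_geometrically_bounded C" and \<mu>: "Re \<mu> > 0" and \<upsilon>: "Re \<upsilon> > 0"
    and pos: "Re \<sigma> > 0" "Re \<tau> > 0" "Re \<alpha> > 0" "Re \<beta> > 0"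
  shows "integrable (lborel \<Otimes>\<^sub>M lborel) (\<lambda>w. causal_power \<sigma> (z - fst w) * causal_power \<tau> (t - snd w) *
           double_frac_series C \<alpha> \<mu> \<beta> \<upsilon> (fst w - a) (snd w - b))"
proof -
  obtain K where K: "K \<ge> 0" "\<And>x y. x \<le> z - a \<Longrightarrow> y \<le> t - b \<Longrightarrow>
    norm (double_frac_series C \<alpha> \<mu> \<beta> \<upsilon> x y) \<le> K * (x powr (Re \<alpha> - 1) * y powr (Re \<beta> - 1))"
    using norm_double_frac_series_le[OF C \<mu> \<upsilon>] by blast
  let ?g = "\<lambda>\<xi>. norm (causal_power \<sigma> (z - \<xi>) * causal_power \<alpha> (\<xi> - a))"
  let ?h = "\<lambda>y. norm (causal_power \<tau> (t - y) * causal_power \<beta> (y - b))"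
  define L where "L = K / (norm (rGamma \<alpha>) * norm (rGamma \<beta>))"
  have nz: "rGamma \<alpha> \<noteq> 0" "rGamma \<beta> \<noteq> 0"
    using Gamma_neq_zero[of \<alpha>] Gamma_neq_zero[of \<beta>] pos by (auto simp: Gamma_def)
  have bound: "norm (causal_power \<sigma> (z - \<xi>) * causal_power \<tau> (t - y) *
      double_frac_series C \<alpha> \<mu> \<beta> \<upsilon> (\<xi> - a) (y - b)) \<le> L * (?g \<xi> * ?h y)" for \<xi> y
  proof (cases "a < \<xi> \<and> \<xi> < z \<and> b < y \<and> y < t")
    case True
    have "norm (causal_power \<sigma> (z - \<xi>) * causal_power \<tau> (t - y) *
        double_frac_series C \<alpha> \<mu> \<beta> \<upsilon> (\<xi> - a) (y - b)) \<le>
        norm (causal_power \<sigma> (z - \<xi>) * causal_power \<tau> (t - y)) *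
        (K * ((\<xi> - a) powr (Re \<alpha> - 1) * (y - b) powr (Re \<beta> - 1)))"
      unfolding norm_mult using True K(2)[of "\<xi> - a" "y - b"]
      by (intro mult_left_mono) (auto simp: norm_mult)
    also have "\<dots> = L * (?g \<xi> * ?h y)"
      using True nz by (simp add: norm_mult norm_causal_power L_def field_simps)
    finally show ?thesis .
  next
    case False
    then have "z - \<xi> \<le> 0 \<or> t - y \<le> 0 \<or> \<xi> - a \<le> 0 \<or> y - b \<le> 0" by linarith
    then have "causal_power \<sigma> (z - \<xi>) * causal_power \<tau> (t - y) *
        double_frac_series C \<alpha> \<mu> \<beta> \<upsilon> (\<xi> - a) (y - b) = 0"
      by (auto simp: double_frac_series_def) (simp add: frac_series_def)
    moreover have "0 \<le> L * (?g \<xi> * ?h y)" using K(1) by (simp add: L_def)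
    ultimately show ?thesis by (simp only: norm_zero)
  qed
  have "integrable (lborel \<Otimes>\<^sub>M lborel) (\<lambda>w. L * (?g (fst w) * ?h (snd w)))"
    by (intro integrable_mult_right integrable_lborel_prod_mult integrable_norm
        integrable_causal_power_conv pos)
  then show ?thesis
  proof (rule Bochner_Integration.integrable_bound)
    show "AE w in lborel \<Otimes>\<^sub>M lborel. norm (causal_power \<sigma> (z - fst w) * causal_power \<tau> (t - snd w) *
           double_frac_series C \<alpha> \<mu> \<beta> \<upsilon> (fst w - a) (snd w - b)) \<le> norm (L * (?g (fst w) * ?h (snd w)))"
      using bound by (intro AE_I2 order_trans[OF bound]) simp
  qed measurable
qed

text \<open>
  The inner integral is a convolution in the first variable.  Transposing the resulting series makes
  the outer integral a convolution of the same kind in the second variable.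
\<close>
theorem double_frac_series_conv:
  assumes C: "double_geometrically_bounded C" and \<mu>: "Re \<mu> > 0" and \<upsilon>: "Re \<upsilon> > 0"
    and pos: "Re \<sigma> > 0" "Re \<tau> > 0" "Re \<alpha> > 0" "Re \<beta> > 0"
  shows "(LINT y|lborel. LINT \<xi>|lborel. causal_power \<sigma> (z - \<xi>) * causal_power \<tau> (t - y) *
           double_frac_series C \<alpha> \<mu> \<beta> \<upsilon> (\<xi> - a) (y - b)) =
         double_frac_series C (\<sigma> + \<alpha>) \<mu> (\<tau> + \<beta>) \<upsilon> (z - a) (t - b)"
proof -
  note CT = double_geometrically_bounded_transpose[OF C]
  have "(LINT \<xi>|lborel. causal_power \<sigma> (z - \<xi>) * causal_power \<tau> (t - y) *
           double_frac_series C \<alpha> \<mu> \<beta> \<upsilon> (\<xi> - a) (y - b)) =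
        causal_power \<tau> (t - y) * double_frac_series (\<lambda>n l. C l n) \<beta> \<upsilon> (\<sigma> + \<alpha>) \<mu> (y - b) (z - a)" for y
  proof -
    have "(LINT \<xi>|lborel. causal_power \<sigma> (z - \<xi>) * causal_power \<tau> (t - y) *
           double_frac_series C \<alpha> \<mu> \<beta> \<upsilon> (\<xi> - a) (y - b)) =
       (LINT \<xi>|lborel. causal_power \<tau> (t - y) * (causal_power \<sigma> (z - \<xi>) *
           double_frac_series C \<alpha> \<mu> \<beta> \<upsilon> (\<xi> - a) (y - b)))"
      by (simp only: mult_ac)
    also have "\<dots> = causal_power \<tau> (t - y) * double_frac_series C (\<sigma> + \<alpha>) \<mu> \<beta> \<upsilon> (z - a) (y - b)"
      unfolding integral_mult_right_zero double_frac_series_def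
      using frac_series_conv[OF geometrically_bounded_row_sums[OF C \<upsilon>] \<mu> pos(1,3)] by simp
    finally show ?thesis using double_frac_series_transpose[OF C \<mu> \<upsilon>] by simp
  qed
  then have "(LINT y|lborel. LINT \<xi>|lborel. causal_power \<sigma> (z - \<xi>) * causal_power \<tau> (t - y) *
           double_frac_series C \<alpha> \<mu> \<beta> \<upsilon> (\<xi> - a) (y - b)) =
      (LINT y|lborel. causal_power \<tau> (t - y) *
         frac_series (\<lambda>n. frac_series (\<lambda>l. C l n) (\<sigma> + \<alpha>) \<mu> (z - a)) \<beta> \<upsilon> (y - b))"
    by (simp add: double_frac_series_def)
  also have "\<dots> = double_frac_series (\<lambda>n l. C l n) (\<tau> + \<beta>) \<upsilon> (\<sigma> + \<alpha>) \<mu> (t - b) (z - a)"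
    using frac_series_conv[OF geometrically_bounded_row_sums[OF CT \<mu>] \<upsilon> pos(2,4)]
    by (simp add: double_frac_series_def)
  finally show ?thesis using double_frac_series_transpose[OF C \<mu> \<upsilon>] by simp
qed

section \<open>Iterated partial derivatives\<close>

text \<open>
  The hypothesis on \<open>F\<close> concerns only \<open>x > a\<close>, \<open>y > b\<close>, because elsewhere iterated derivatives of \<open>F\<close> are
  arbitrary.  This suffices since that region is open.
\<close>
lemma has_vector_derivative_partial_fst:
  assumes C: "double_geometrically_bounded C" and \<mu>: "Re \<mu> > 0" and \<upsilon>: "Re \<upsilon> > 0"
    and F: "\<And>x y. x > a \<Longrightarrow> y > b \<Longrightarrow> F x y = double_frac_series C \<alpha> \<mu> \<beta> \<upsilon> (x - a) (y - b)"
    and z: "z > a" and t: "t > b"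
  shows "((\<lambda>x. F x t) has_vector_derivative double_frac_series C (\<alpha> - 1) \<mu> \<beta> \<upsilon> (z - a) (t - b)) (at z)"
proof -
  have "((\<lambda>x. x - a) has_vector_derivative 1) (at z)"
    by (auto intro!: derivative_eq_intros simp flip: has_real_derivative_iff_has_vector_derivative)
  from vector_diff_chain_at[OF this, of
      "\<lambda>x. double_frac_series C \<alpha> \<mu> \<beta> \<upsilon> x (t - b)"
      "double_frac_series C (\<alpha> - 1) \<mu> \<beta> \<upsilon> (z - a) (t - b)"]
  have "((\<lambda>x. double_frac_series C \<alpha> \<mu> \<beta> \<upsilon> (x - a) (t - b)) has_vector_derivative
      double_frac_series C (\<alpha> - 1) \<mu> \<beta> \<upsilon> (z - a) (t - b)) (at z)"
    using has_vector_derivative_frac_series[OF geometrically_bounded_row_sums[OF C \<upsilon>] \<mu>] z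
    by (simp add: double_frac_series_def o_def)
  then show ?thesis
    by (rule has_vector_derivative_transform_within_open[of _ _ _ "{a<..}"]) (use F z t in auto)
qed

lemma partial_fst_power:
  assumes C: "double_geometrically_bounded C" and \<mu>: "Re \<mu> > 0" and \<upsilon>: "Re \<upsilon> > 0"
    and F: "\<And>x y. x > a \<Longrightarrow> y > b \<Longrightarrow> F x y = double_frac_series C \<alpha> \<mu> \<beta> \<upsilon> (x - a) (y - b)"
    and z: "z > a" and t: "t > b"
  shows "(partial_fst ^^ i) F z t = double_frac_series C (\<alpha> - of_nat i) \<mu> \<beta> \<upsilon> (z - a) (t - b)"
  using z t
proof (induction i arbitrary: z t)
  case 0
  then show ?case by (simp add: F)
next
  case (Suc i)
  from has_vector_derivative_partial_fst[OF C \<mu> \<upsilon> Suc.IH Suc.prems]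
  have "partial_fst ((partial_fst ^^ i) F) z t =
      double_frac_series C (\<alpha> - of_nat i - 1) \<mu> \<beta> \<upsilon> (z - a) (t - b)"
    unfolding partial_fst_def by (rule vector_derivative_at)
  then show ?case by (simp add: algebra_simps)
qed

text \<open>
  Differentiation in the second variable is differentiation in the first one with the arguments
  exchanged.  Together with the transposition of double series, this makes a separate treatment of the
  second variable superfluous.
\<close>
lemma partial_snd_power:
  "(partial_snd ^^ j) F z t = (partial_fst ^^ j) (\<lambda>y x. F x y) t z"
proof (induction j arbitrary: z t)
  case (Suc j)
  have "(\<lambda>y. (partial_snd ^^ j) F z y) = (\<lambda>y. (partial_fst ^^ j) (\<lambda>y x. F x y) y z)"
    by (rule ext) (rule Suc.IH)
  then show ?case
    by (simp only: funpow.simps o_apply partial_snd_def[of "(partial_snd ^^ j) F"]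
        partial_fst_def[of "(partial_fst ^^ j) (\<lambda>y x. F x y)"])
qed simp

lemma differentiable_partial_powers:
  assumes C: "double_geometrically_bounded C" and \<mu>: "Re \<mu> > 0" and \<upsilon>: "Re \<upsilon> > 0"
    and F: "\<And>x y. x > a \<Longrightarrow> y > b \<Longrightarrow> F x y = double_frac_series C \<alpha> \<mu> \<beta> \<upsilon> (x - a) (y - b)"
    and z: "z > a" and t: "t > b"
  shows "(\<lambda>x. (partial_fst ^^ i) F x t) differentiable at z"
    and "(\<lambda>y. (partial_snd ^^ j) ((partial_fst ^^ k) F) z y) differentiable at t"
    and "(partial_snd ^^ j) ((partial_fst ^^ k) F) z t =
      double_frac_series C (\<alpha> - of_nat k) \<mu> (\<beta> - of_nat j) \<upsilon> (z - a) (t - b)"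
proof -
  show "(\<lambda>x. (partial_fst ^^ i) F x t) differentiable at z"
    using has_vector_derivative_partial_fst[OF C \<mu> \<upsilon> partial_fst_power[OF C \<mu> \<upsilon> F] z t]
    by (rule differentiableI_vector)
  note CT = double_geometrically_bounded_transpose[OF C]
  have G: "(partial_fst ^^ k) F x y =
      double_frac_series (\<lambda>n l. C l n) \<beta> \<upsilon> (\<alpha> - of_nat k) \<mu> (y - b) (x - a)"
    if "y > b" "x > a" for x y
    using partial_fst_power[OF C \<mu> \<upsilon> F that(2,1)] double_frac_series_transpose[OF C \<mu> \<upsilon>] by simp
  show "(\<lambda>y. (partial_snd ^^ j) ((partial_fst ^^ k) F) z y) differentiable at t"
    unfolding partial_snd_power
    using has_vector_derivative_partial_fst[OF CT \<upsilon> \<mu> partial_fst_power[OF CT \<upsilon> \<mu> G] t z]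
    by (rule differentiableI_vector)
  show "(partial_snd ^^ j) ((partial_fst ^^ k) F) z t =
      double_frac_series C (\<alpha> - of_nat k) \<mu> (\<beta> - of_nat j) \<upsilon> (z - a) (t - b)"
    unfolding partial_snd_power
    using partial_fst_power[OF CT \<upsilon> \<mu> G t z] double_frac_series_transpose[OF C \<mu> \<upsilon>] by simp
qed

section \<open>Coefficients of the Mittag-Leffler function\<close>

definition ikml_coeff ::
  "complex \<Rightarrow> complex \<Rightarrow> complex \<Rightarrow> complex \<Rightarrow> complex \<Rightarrow> complex \<Rightarrow>
   complex \<Rightarrow> complex \<Rightarrow> nat \<Rightarrow> nat \<Rightarrow> complex" where
  "ikml_coeff \<gamma>1 \<gamma>2 \<gamma>3 \<gamma>4 \<gamma>5 \<gamma>6 w W l n =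
     (-1) ^ l * pochhammer \<gamma>1 (2 * l) * pochhammer \<gamma>2 (l + n) * pochhammer \<gamma>3 l * w ^ l * W ^ n
     / (pochhammer \<gamma>4 l * pochhammer \<gamma>5 l * pochhammer \<gamma>6 l) / (fact n * fact l)"

lemma norm_pochhammer_le: "norm (pochhammer (\<gamma> :: complex) m) \<le> (norm \<gamma> + 1) ^ m * fact m"
proof (induction m)
  case (Suc m)
  have "norm (\<gamma> + of_nat m) \<le> norm \<gamma> + real m"
    using norm_triangle_ineq[of \<gamma> "of_nat m"] by simp
  also have "\<dots> \<le> (norm \<gamma> + 1) * (real m + 1)" by (simp add: algebra_simps)
  finally have "norm (pochhammer \<gamma> m) * norm (\<gamma> + of_nat m) \<le>
      ((norm \<gamma> + 1) ^ m * fact m) * ((norm \<gamma> + 1) * (real m + 1))"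
    using Suc by (intro mult_mono) auto
  also have "\<dots> = (norm \<gamma> + 1) ^ Suc m * fact (Suc m)" by (simp add: mult_ac add.commute)
  finally show ?case by (simp only: pochhammer_Suc norm_mult)
qed simp

text \<open>
  The quotient \<open>m!/(\<gamma>)\<^sub>m\<close> is the product of the factors \<open>(i + 1)/(\<gamma> + i)\<close> for \<open>i < m\<close>, and these are bounded because
  they tend to \<open>1\<close>.
\<close>
lemma fact_le_norm_pochhammer:
  fixes \<gamma> :: complex
  assumes "\<gamma> \<notin> \<int>\<^sub>\<le>\<^sub>0"
  obtains D where "D > 0" "\<And>m. fact m / norm (pochhammer \<gamma> m) \<le> D ^ m"
proof -
  have nz: "\<gamma> + of_nat i \<noteq> 0" for i
    using assms by (metis add.commute add_eq_0_iff minus_of_nat_in_nonpos_Ints)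
  have "(\<lambda>i. (of_nat i + 1) / (\<gamma> + of_nat i)) \<longlonglongrightarrow> 1"
  proof -
    have "(\<lambda>i. (1 - \<gamma>) * inverse (\<gamma> + of_nat i) + 1) \<longlonglongrightarrow> (1 - \<gamma>) * 0 + 1"
      by (intro tendsto_intros tendsto_inverse_0[THEN filterlim_compose]
           tendsto_add_filterlim_at_infinity[OF tendsto_const tendsto_of_nat])
    moreover have "(1 - \<gamma>) * inverse (\<gamma> + of_nat i) + 1 = (of_nat i + 1) / (\<gamma> + of_nat i)" for i
      using nz[of i] by (simp add: field_simps)
    ultimately show ?thesis by simp
  qed
  then have "Bseq (\<lambda>i. (of_nat i + 1) / (\<gamma> + of_nat i))"
    by (intro convergent_imp_Bseq convergentI)
  then obtain D where D: "D > 0" "\<And>i. norm ((of_nat i + 1) / (\<gamma> + of_nat i)) \<le> D"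
    by (auto elim: BseqE)
  have "fact m / norm (pochhammer \<gamma> m) \<le> D ^ m" for m
  proof (induction m)
    case (Suc m)
    have "norm (complex_of_nat m + 1) = real m + 1"
      by (metis norm_of_nat of_nat_Suc add.commute)
    then have "fact (Suc m) / norm (pochhammer \<gamma> (Suc m)) =
        norm ((of_nat m + 1) / (\<gamma> + of_nat m)) * (fact m / norm (pochhammer \<gamma> m))"
      by (simp add: pochhammer_Suc norm_mult norm_divide mult_ac)
    also have "\<dots> \<le> D * D ^ m"
      using D Suc by (intro mult_mono) auto
    finally show ?case by simp
  qed simp
  with D(1) show ?thesis using that by blast
qed

lemma fact_add_le: "fact (l + n) \<le> (2 :: real) ^ l * 2 ^ n * (fact l * fact n)"
proof -
  have "real ((l + n) choose l) \<le> 2 ^ (l + n)"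
    using binomial_le_pow2[of "l + n" l] by (metis of_nat_le_iff of_nat_numeral of_nat_power)
  then show ?thesis
    by (simp add: binomial_fact power_add field_simps)
qed

text \<open>
  Up to geometric factors \<open>(\<gamma>)\<^sub>m\<close> has the size of \<open>m!\<close>, and \<open>(l + n)!\<close> that of \<open>l! n!\<close>.  The factorials then
  cancel: in the numerator \<open>(2l)! (l+n)! l!\<close> counts as \<open>(l!)\<^sup>4 n!\<close>, which is also the size of the
  denominator \<open>(l!)\<^sup>3 n! l!\<close>.
\<close>
lemma double_geometrically_bounded_ikml_coeff:
  assumes "\<gamma>4 \<notin> \<int>\<^sub>\<le>\<^sub>0" "\<gamma>5 \<notin> \<int>\<^sub>\<le>\<^sub>0" "\<gamma>6 \<notin> \<int>\<^sub>\<le>\<^sub>0"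
  shows "double_geometrically_bounded (ikml_coeff \<gamma>1 \<gamma>2 \<gamma>3 \<gamma>4 \<gamma>5 \<gamma>6 w W)"
proof -
  obtain D4 where D4: "D4 > 0" "\<And>m. fact m / norm (pochhammer \<gamma>4 m) \<le> D4 ^ m"
    using fact_le_norm_pochhammer[OF assms(1)] by blast
  obtain D5 where D5: "D5 > 0" "\<And>m. fact m / norm (pochhammer \<gamma>5 m) \<le> D5 ^ m"
    using fact_le_norm_pochhammer[OF assms(2)] by blast
  obtain D6 where D6: "D6 > 0" "\<And>m. fact m / norm (pochhammer \<gamma>6 m) \<le> D6 ^ m"
    using fact_le_norm_pochhammer[OF assms(3)] by blast
  define g where "g = (\<lambda>\<gamma>::complex. norm \<gamma> + 1)"
  have g: "g \<gamma> \<ge> 0" "norm (pochhammer \<gamma> m) \<le> g \<gamma> ^ m * fact m" for \<gamma> m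
    using norm_pochhammer_le by (auto simp: g_def)
  define A where "A = (4 * g \<gamma>1 ^ 2) * (2 * g \<gamma>2) * g \<gamma>3 * norm w * (D4 * D5 * D6)"
  define B where "B = 2 * g \<gamma>2 * norm W"
  have nonneg: "A \<ge> 0" "B \<ge> 0"
    using g(1) D4(1) D5(1) D6(1) by (auto simp: A_def B_def)
  have "norm (ikml_coeff \<gamma>1 \<gamma>2 \<gamma>3 \<gamma>4 \<gamma>5 \<gamma>6 w W l n) \<le> A ^ l * B ^ n" for l n
  proof -
    have p1: "norm (pochhammer \<gamma>1 (2 * l)) / (fact l * fact l) \<le> (4 * g \<gamma>1 ^ 2) ^ l"
    proof -
      have "norm (pochhammer \<gamma>1 (l + l)) \<le> g \<gamma>1 ^ (l + l) * (2 ^ l * 2 ^ l * (fact l * fact l))"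
        by (rule order_trans[OF g(2) mult_left_mono[OF fact_add_le]]) (simp add: g(1))
      then have "norm (pochhammer \<gamma>1 (2 * l)) \<le> g \<gamma>1 ^ (2 * l) * (2 ^ l * 2 ^ l * (fact l * fact l))"
        by (simp only: mult_2)
      then have "norm (pochhammer \<gamma>1 (2 * l)) / (fact l * fact l) \<le> g \<gamma>1 ^ (2 * l) * (2 ^ l * 2 ^ l)"
        by (simp add: field_simps)
      also have "\<dots> = (4 * g \<gamma>1 ^ 2) ^ l"
        by (simp add: power_mult power_mult_distrib flip: power_mult_distrib[of 2 2 l])
      finally show ?thesis .
    qed
    have p2: "norm (pochhammer \<gamma>2 (l + n)) / (fact n * fact l) \<le> (2 * g \<gamma>2) ^ l * (2 * g \<gamma>2) ^ n"
    proof -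
      have "norm (pochhammer \<gamma>2 (l + n)) \<le> g \<gamma>2 ^ (l + n) * (2 ^ l * 2 ^ n * (fact l * fact n))"
        by (rule order_trans[OF g(2) mult_left_mono[OF fact_add_le]]) (simp add: g(1))
      then show ?thesis by (simp add: field_simps power_add power_mult_distrib)
    qed
    have p3: "norm (pochhammer \<gamma>3 l) / fact l \<le> g \<gamma>3 ^ l"
      using g(2)[of \<gamma>3 l] by (simp add: field_simps)
    have "norm (ikml_coeff \<gamma>1 \<gamma>2 \<gamma>3 \<gamma>4 \<gamma>5 \<gamma>6 w W l n) =
       (norm (pochhammer \<gamma>1 (2 * l)) / (fact l * fact l)) *
       (norm (pochhammer \<gamma>2 (l + n)) / (fact n * fact l)) *
       (norm (pochhammer \<gamma>3 l) / fact l) * norm w ^ l * norm W ^ n *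
       ((fact l / norm (pochhammer \<gamma>4 l)) * (fact l / norm (pochhammer \<gamma>5 l)) *
        (fact l / norm (pochhammer \<gamma>6 l)))"
      by (simp add: ikml_coeff_def norm_mult norm_divide norm_power mult_ac)
    also have "\<dots> \<le> (4 * g \<gamma>1 ^ 2) ^ l * ((2 * g \<gamma>2) ^ l * (2 * g \<gamma>2) ^ n) * g \<gamma>3 ^ l *
        norm w ^ l * norm W ^ n * (D4 ^ l * D5 ^ l * D6 ^ l)"
      using g(1) D4(1) D5(1) D6(1)
      by (intro mult_mono p1 p2 p3 D4(2) D5(2) D6(2)) (auto intro!: mult_nonneg_nonneg)
    also have "\<dots> = A ^ l * B ^ n"
      by (simp only: A_def B_def power_mult_distrib mult_ac)
    finally show ?thesis .
  qed
  also have "A ^ l * B ^ n \<le> 1 * max A B ^ l * max A B ^ n" for l n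
    using nonneg by (auto intro!: mult_mono power_mono)
  finally have "norm (ikml_coeff \<gamma>1 \<gamma>2 \<gamma>3 \<gamma>4 \<gamma>5 \<gamma>6 w W l n) \<le> 1 * max A B ^ l * max A B ^ n" for l n .
  then show ?thesis
    unfolding double_geometrically_bounded_def
    by - (rule exI[of _ 1], rule exI[of _ "max A B"], use nonneg in auto)
qed

text \<open>
  The powers in front of the Mittag-Leffler function are exactly what turns \<open>x\<^sup>l/\<Gamma>(p+l)\<close> and
  \<open>y\<^bsup>\<upsilon>n\<^esup>/\<Gamma>(q+\<upsilon>n)\<close> into causal powers.
\<close>
lemma ikml_eq_double_frac_series:
  assumes C: "double_geometrically_bounded (ikml_coeff \<gamma>1 \<gamma>2 \<gamma>3 \<gamma>4 \<gamma>5 \<gamma>6 w W)"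
    and \<upsilon>: "Re \<upsilon> > 0" and x: "x > 0" and y: "y > 0"
  shows "of_real x powr (p - 1) * of_real y powr (q - 1) *
           ikml \<gamma>1 \<gamma>2 \<gamma>3 \<gamma>4 \<gamma>5 \<gamma>6 p q \<upsilon> W (w * of_real x) y =
         double_frac_series (ikml_coeff \<gamma>1 \<gamma>2 \<gamma>3 \<gamma>4 \<gamma>5 \<gamma>6 w W) p 1 q \<upsilon> x y"
proof -
  let ?C = "ikml_coeff \<gamma>1 \<gamma>2 \<gamma>3 \<gamma>4 \<gamma>5 \<gamma>6 w W"
  let ?X = "of_real x powr (p - 1) :: complex" and ?Y = "of_real y powr (q - 1) :: complex"
  have nz: "?X \<noteq> 0" "?Y \<noteq> 0" using x y by auto
  have cx: "causal_power (p + 1 * of_nat l) x = ?X * of_real x ^ l * rGamma (p + of_nat l)" for l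
  proof -
    have "of_real x powr (p + of_nat l - 1) = (of_real x powr (p - 1 + of_nat l) :: complex)"
      by (simp add: algebra_simps)
    also have "\<dots> = ?X * of_real x ^ l"
      using x by (simp only: powr_add) (simp add: powr_nat')
    finally show ?thesis using x by (simp add: causal_power_def)
  qed
  have cy: "causal_power (q + \<upsilon> * of_nat n) y = ?Y * of_real y powr (\<upsilon> * of_nat n) * rGamma (q + \<upsilon> * of_nat n)" for n
  proof -
    have "of_real y powr (q + \<upsilon> * of_nat n - 1) = (of_real y powr (q - 1 + \<upsilon> * of_nat n) :: complex)"
      by (simp add: algebra_simps)
    then show ?thesis using y by (simp add: causal_power_def powr_add)
  qed
  define T where "T = (\<lambda>l n. (-1) ^ l * pochhammer \<gamma>1 (2 * l) * pochhammer \<gamma>2 (l + n) * pochhammer \<gamma>3 l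
        * (w * of_real x) ^ l * (W ^ n * of_real y powr (\<upsilon> * of_nat n))
        / (pochhammer \<gamma>4 l * pochhammer \<gamma>5 l * pochhammer \<gamma>6 l)
        * rGamma (p + of_nat l) * rGamma (q + \<upsilon> * of_nat n) / (fact n * fact l))"
  have T: "T l n = (inverse ?Y * (inverse ?X * causal_power (p + 1 * of_nat l) x)) *
      (?C l n * causal_power (q + \<upsilon> * of_nat n) y)" for l n
  proof -
    have "inverse ?X * causal_power (p + 1 * of_nat l) x = of_real x ^ l * rGamma (p + of_nat l)"
      by (simp only: cx mult.assoc [symmetric] left_inverse[OF nz(1)])
         (simp only: mult_1_left)
    moreover have "inverse ?Y * causal_power (q + \<upsilon> * of_nat n) y =
        of_real y powr (\<upsilon> * of_nat n) * rGamma (q + \<upsilon> * of_nat n)"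
      by (simp only: cy mult.assoc [symmetric] left_inverse[OF nz(2)])
         (simp only: mult_1_left)
    ultimately have "T l n = (inverse ?X * causal_power (p + 1 * of_nat l) x) *
        (?C l n * (inverse ?Y * causal_power (q + \<upsilon> * of_nat n) y))"
      by (simp only: T_def ikml_coeff_def power_mult_distrib) (simp add: mult_ac)
    then show ?thesis by (simp only: mult_ac)
  qed
  have inner: "(\<Sum>n. T l n) = inverse ?X * inverse ?Y * (frac_series (?C l) q \<upsilon> y * causal_power (p + 1 * of_nat l) x)" for l
  proof -
    have "(\<Sum>n. T l n) = (inverse ?Y * (inverse ?X * causal_power (p + 1 * of_nat l) x)) *
        frac_series (?C l) q \<upsilon> y"
      unfolding T frac_series_def
      by (intro suminf_mult summable_norm_cancel[OF summable_frac_series] \<upsilon>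
          double_geometrically_bounded_row C)
    then show ?thesis by (simp only: mult_ac)
  qed
  have "ikml \<gamma>1 \<gamma>2 \<gamma>3 \<gamma>4 \<gamma>5 \<gamma>6 p q \<upsilon> W (w * of_real x) y = (\<Sum>l. \<Sum>n. T l n)"
    by (simp only: ikml_def T_def)
  also have "\<dots> = inverse ?X * inverse ?Y * double_frac_series ?C p 1 q \<upsilon> x y"
    unfolding inner unfolding double_frac_series_def frac_series_def[of _ p]
    by (intro suminf_mult summable_norm_cancel[OF summable_frac_series]
        geometrically_bounded_row_sums C \<upsilon>) simp
  finally have "?X * ?Y * ikml \<gamma>1 \<gamma>2 \<gamma>3 \<gamma>4 \<gamma>5 \<gamma>6 p q \<upsilon> W (w * of_real x) y =
      (?X * inverse ?X) * ((?Y * inverse ?Y) * double_frac_series ?C p 1 q \<upsilon> x y)"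
    by (simp only: mult_ac)
  then show ?thesis
    by (simp only: right_inverse[OF nz(1)] right_inverse[OF nz(2)] mult_1_left)
qed

section \<open>The double fractional derivative\<close>

text \<open>
  The equality holds at every point, also on the boundary of the rectangle: there the kernel
  contains a power of \<open>0\<close>, whose value is \<open>0\<close>, or \<open>d\<close> vanishes.
\<close>
lemma frac_kernel_indicator:
  assumes pos: "Re \<sigma> > 0" "Re \<tau> > 0"
    and d: "\<And>x y. x > a \<Longrightarrow> y > b \<Longrightarrow> d x y = double_frac_series C p \<mu> q \<upsilon> (x - a) (y - b)"
    and d0: "\<And>y. d a y = 0" "\<And>x. d x b = 0"
  shows "(indicator {a..z} \<xi> * indicator {b..t} y) *\<^sub>R frac_kernel \<sigma> \<tau> d z t \<xi> y =
     (Gamma \<tau> * Gamma \<sigma>) * (causal_power \<sigma> (z - \<xi>) * causal_power \<tau> (t - y) *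
       double_frac_series C p \<mu> q \<upsilon> (\<xi> - a) (y - b))"
proof (cases "a < \<xi> \<and> \<xi> < z \<and> b < y \<and> y < t")
  case True
  have "Gamma \<sigma> * rGamma \<sigma> = 1" "Gamma \<tau> * rGamma \<tau> = 1"
    using pos Gamma_neq_zero by (simp_all add: rGamma_inverse_Gamma)
  then have "of_real (z - \<xi>) powr (\<sigma> - 1) = Gamma \<sigma> * causal_power \<sigma> (z - \<xi>)"
    "of_real (t - y) powr (\<tau> - 1) = Gamma \<tau> * causal_power \<tau> (t - y)"
    using True by (simp_all add: causal_power_def)
  then show ?thesis using True by (simp add: frac_kernel_def d del: of_real_diff)
next
  case False
  then have "z - \<xi> \<le> 0 \<or> t - y \<le> 0 \<or> \<xi> - a \<le> 0 \<or> y - b \<le> 0" by linarith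
  then have "causal_power \<sigma> (z - \<xi>) * causal_power \<tau> (t - y) *
      double_frac_series C p \<mu> q \<upsilon> (\<xi> - a) (y - b) = 0"
    by (auto simp: double_frac_series_def) (simp add: frac_series_def)
  moreover have "(indicator {a..z} \<xi> * indicator {b..t} y) *\<^sub>R frac_kernel \<sigma> \<tau> d z t \<xi> y = 0"
  proof (cases "\<xi> \<in> {a..z} \<and> y \<in> {b..t}")
    case True
    with False have "\<xi> = a \<or> \<xi> = z \<or> y = b \<or> y = t" by auto
    then show ?thesis by (auto simp: frac_kernel_def d0)
  qed (auto simp: indicator_def)
  ultimately show ?thesis by (simp only: mult_zero_right)
qed

lemma
  assumes C: "double_geometrically_bounded C" and \<mu>: "Re \<mu> > 0" and \<upsilon>: "Re \<upsilon> > 0"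
    and pos: "Re \<sigma> > 0" "Re \<tau> > 0" "Re p > 0" "Re q > 0"
    and d: "\<And>x y. x > a \<Longrightarrow> y > b \<Longrightarrow> d x y = double_frac_series C p \<mu> q \<upsilon> (x - a) (y - b)"
    and d0: "\<And>y. d a y = 0" "\<And>x. d x b = 0"
  shows set_integrable_frac_kernel:
      "set_integrable lborel ({a..z} \<times> {b..t}) (\<lambda>(\<xi>, y). frac_kernel \<sigma> \<tau> d z t \<xi> y)"
    and double_frac_integral_eq:
      "double_frac_integral \<sigma> \<tau> a b d z t = double_frac_series C (\<sigma> + p) \<mu> (\<tau> + q) \<upsilon> (z - a) (t - b)"
proof -
  let ?k = "\<lambda>\<xi> y. causal_power \<sigma> (z - \<xi>) * causal_power \<tau> (t - y) *
       double_frac_series C p \<mu> q \<upsilon> (\<xi> - a) (y - b)"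
  have ind: "(indicator {a..z} \<xi> * indicator {b..t} y) *\<^sub>R frac_kernel \<sigma> \<tau> d z t \<xi> y =
      (Gamma \<tau> * Gamma \<sigma>) * ?k \<xi> y" for \<xi> y
    by (rule frac_kernel_indicator[OF pos(1,2)]) (simp_all add: d d0)
  have "(\<lambda>w. indicator ({a..z} \<times> {b..t}) w *\<^sub>R (case w of (\<xi>, y) \<Rightarrow> frac_kernel \<sigma> \<tau> d z t \<xi> y)) =
      (\<lambda>w. (Gamma \<tau> * Gamma \<sigma>) * ?k (fst w) (snd w))"
    by (auto simp: fun_eq_iff indicator_times ind simp del: scaleR_conv_of_real)
  then show "set_integrable lborel ({a..z} \<times> {b..t}) (\<lambda>(\<xi>, y). frac_kernel \<sigma> \<tau> d z t \<xi> y)"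
    using integrable_mult_right[OF integrable_double_frac_series_conv[OF C \<mu> \<upsilon> pos],
        of "Gamma \<tau> * Gamma \<sigma>" z t a b]
    by (simp only: set_integrable_def lborel_prod)
  have "(LINT y:{b..t}|lborel. LINT \<xi>:{a..z}|lborel. frac_kernel \<sigma> \<tau> d z t \<xi> y) =
      (LINT y|lborel. LINT \<xi>|lborel. (indicator {a..z} \<xi> * indicator {b..t} y) *\<^sub>R frac_kernel \<sigma> \<tau> d z t \<xi> y)"
    unfolding set_lebesgue_integral_def by (simp flip: integral_scaleR_right add: mult.commute)
  also have "\<dots> = (Gamma \<tau> * Gamma \<sigma>) * double_frac_series C (\<sigma> + p) \<mu> (\<tau> + q) \<upsilon> (z - a) (t - b)"
    unfolding ind integral_mult_right_zero double_frac_series_conv[OF C \<mu> \<upsilon> pos] ..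
  finally show "double_frac_integral \<sigma> \<tau> a b d z t =
      double_frac_series C (\<sigma> + p) \<mu> (\<tau> + q) \<upsilon> (z - a) (t - b)"
    using Gamma_neq_zero pos by (simp add: double_frac_integral_def)
qed

theorem theorem52:
  fixes p q \<upsilon> \<gamma>1 \<gamma>2 \<gamma>3 \<gamma>4 \<gamma>5 \<gamma>6 \<sigma> \<tau> w1 w2 W :: complex and a b z t :: real
  assumes "Re p > 0" and "Re q > 0" and "Re \<upsilon> > 0"
    and "\<gamma>4 \<notin> \<int>\<^sub>\<le>\<^sub>0" and "\<gamma>5 \<notin> \<int>\<^sub>\<le>\<^sub>0" and "\<gamma>6 \<notin> \<int>\<^sub>\<le>\<^sub>0"
    and "Re \<sigma> \<ge> 0" and "Re (p - \<sigma>) \<ge> 0" and "Re \<tau> \<ge> 0" and "Re (q - \<tau>) \<ge> 0"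
    and "is_power_value w2 \<upsilon> W"
    and "z > a" and "t > b"
  defines "d \<equiv> (\<lambda>x y. of_real (x - a) powr (p - 1) * of_real (y - b) powr (q - 1)
             * ikml \<gamma>1 \<gamma>2 \<gamma>3 \<gamma>4 \<gamma>5 \<gamma>6 p q \<upsilon> W (w1 * of_real (x - a)) (y - b))"
  shows "has_double_frac_deriv \<sigma> \<tau> a b d \<and>
         double_frac_deriv \<sigma> \<tau> a b d z t =
           of_real (z - a) powr (p - \<sigma> - 1) * of_real (t - b) powr (q - \<tau> - 1)
           * ikml \<gamma>1 \<gamma>2 \<gamma>3 \<gamma>4 \<gamma>5 \<gamma>6 (p - \<sigma>) (q - \<tau>) \<upsilon> W (w1 * of_real (z - a)) (t - b)"
proof -
  define C where "C = ikml_coeff \<gamma>1 \<gamma>2 \<gamma>3 \<gamma>4 \<gamma>5 \<gamma>6 w1 W"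
  define k where "k = deriv_order \<sigma>"
  define s where "s = deriv_order \<tau>"
  define F where "F = double_frac_integral (of_nat k - \<sigma>) (of_nat s - \<tau>) a b d"
  have C: "double_geometrically_bounded C"
    unfolding C_def by (rule double_geometrically_bounded_ikml_coeff) fact+
  \<comment> \<open>The exponents of \<open>x - a\<close> advance in steps of \<open>1\<close>, those of \<open>y - b\<close> in steps of \<open>\<upsilon>\<close>.\<close>
  have one: "Re 1 > 0" by simp
  have \<upsilon>: "Re \<upsilon> > 0" by fact
  have "Re \<sigma> < real (deriv_order \<sigma>)" for \<sigma>
    unfolding deriv_order_def by linarith
  then have pos: "Re (of_nat k - \<sigma>) > 0" "Re (of_nat s - \<tau>) > 0" "Re p > 0" "Re q > 0"
    using assms by (simp_all add: k_def s_def)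
  have ikml: "of_real x powr (p' - 1) * of_real y powr (q' - 1) *
        ikml \<gamma>1 \<gamma>2 \<gamma>3 \<gamma>4 \<gamma>5 \<gamma>6 p' q' \<upsilon> W (w1 * of_real x) y = double_frac_series C p' 1 q' \<upsilon> x y"
    if "x > 0" "y > 0" for x y p' q'
    using ikml_eq_double_frac_series[OF C[unfolded C_def] \<upsilon> that] by (simp only: C_def)
  have d: "d x y = double_frac_series C p 1 q \<upsilon> (x - a) (y - b)" if "x > a" "y > b" for x y
    unfolding d_def by (rule ikml) (use that in auto)
  have d0: "d a y = 0" "d x b = 0" for x y
    by (simp_all add: d_def)
  note integrable = set_integrable_frac_kernel[where d = d, OF C one \<upsilon> pos d d0]
  have F: "F x y = double_frac_series C (of_nat k - \<sigma> + p) 1 (of_nat s - \<tau> + q) \<upsilon> (x - a) (y - b)" for x y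
    unfolding F_def by (rule double_frac_integral_eq[where d = d, OF C one \<upsilon> pos d d0])
  note deriv = differentiable_partial_powers[where F = F, OF C one \<upsilon> F]
  have "has_double_frac_deriv \<sigma> \<tau> a b d"
    unfolding has_double_frac_deriv_def Let_def
    using integrable deriv(1,2) by (simp add: k_def s_def F_def)
  moreover have "double_frac_deriv \<sigma> \<tau> a b d z t = double_frac_series C (p - \<sigma>) 1 (q - \<tau>) \<upsilon> (z - a) (t - b)"
    using deriv(3)[where j = s and k = k, OF assms(12,13)]
    by (simp add: double_frac_deriv_def k_def s_def F_def)
  ultimately show ?thesis
    using ikml[of "z - a" "t - b" "p - \<sigma>" "q - \<tau>"] assms(12,13) by simp
qed

end
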